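(* Let $G\rightrightarrows X$ be a Lie groupoid, $n\ge1$, and let $\Omega:G^{(n)}\to\mathbb{C}$ be a normalized, $S_n$-antisymmetric $n$-cochain on $G$. Let $x\in X$, let $(y^1,\ldots,y^m)$ be local coordinates on the source fiber $s^{-1}(x)$ in a neighborhood of the identity arrow at $x$, let $(x^1,\ldots,x^m)$ be the coordinates of that identity arrow, and let $(y_1^1,\ldots,y_1^m,\ldots,y_n^1,\ldots,y_n^m)$ be the induced coordinates on $G^{(n)}_x=s^{-1}(x)\times\cdots\times s^{-1}(x)$ ($n$ factors) near $(x,\ldots,x)$. Then, up to order $n$ in these coordinates, the asymptotic (Taylor) expansion at the point $(x,\ldots,x)$ of the restriction $\Omega_x=\Omega|_{G^{(n)}_x}$ is given by $$\sum_{i_1<\cdots<i_n}\frac{1}{n!}\,VE(\Omega)(\partial_{y^{i_1}},\ldots,\partial_{y^{i_n}})\,\mathrm{Vol}_\Delta(x^{i_1},\ldots,x^{i_n},y_1^{i_1},\ldots,y_1^{i_n},\ldots,y_n^{i_1},\ldots,y_n^{i_n}),$$ where $i_1,\ldots,i_n\in\{1,\ldots,m\}$; that is, this polynomial is the Taylor polynomial of $\Omega_x$ of total degree $n$ at $(x,\ldots,x)$. Here $\mathrm{Vol}_\Delta(x^{i_1},\ldots,x^{i_n},y_1^{i_1},\ldots,y_n^{i_n})$ is the determinant of the $n$ vectors $(y_1^{i_1}-x^{i_1},\ldots,y_1^{i_n}-x^{i_n}),\ldots,(y_n^{i_1}-x^{i_1},\ldots,y_n^{i_n}-x^{i_n})\in\mathbb{R}^n$,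 and $\partial_{y^j}\in\mathfrak{g}_x$ is the coordinate vector at the identity arrow at $x$.
   Context: For a Lie groupoid $G\rightrightarrows X$ with source $s$ and target $t$, composition $gh$ is defined when $t(g)=s(h)$. Write $G^{(n)}=\{(g_1,\ldots,g_n)\in G^n: s(g_1)=\cdots=s(g_n)\}$, which is identified with the space of $n$-composable arrows via $(g_1,\ldots,g_n)\mapsto(g_1,g_1g_2,\ldots,g_1\cdots g_n)$. An $n$-cochain is a smooth function $\Omega:G^{(n)}\to\mathbb{C}$. It is normalized if $\Omega(g_1,\ldots,g_n)=0$ whenever some $g_j$ is an identity arrow. It is $S_n$-antisymmetric if $\Omega(g_{\sigma(1)},\ldots,g_{\sigma(n)})=\mathrm{sgn}(\sigma)\Omega(g_1,\ldots,g_n)$ for all $\sigma\in S_n$. For $x\in X$, $G^{(n)}_x=\{(g_1,\ldots,g_n)\in G^{(n)}:s(g_1)=x\}$, and $(x,\ldots,x)$ denotes the tuple of identity arrows at $x$. The Lie algebroid $\mathfrak{g}\to X$ has fiber $\mathfrak{g}_x=T_{\mathrm{id}_x}s^{-1}(x)$, the vectors tangent to the source fiber at the identity. The van Est map is $$VE(\Omega)(V_1,\ldots,V_n)=n!\,V_1\cdots V_n\,\mathrm{Alt}_n(\Omega),\qquad V_1,\ldots,V_n\in\mathfrak{g}_x,$$ where $V_j$ differentiates in the $j$th component at the identity arrow $\mathrm{id}_x$, and $\mathrm{Alt}_n(\Omega)(g_1,\ldots,g_n)=\frac1{n!}\sum_{\sigma\in S_n}\mathrm{sgn}(\sigma)\,\Omega(g_{\sigma(1)},\ldots,g_{\sigma(n)})$.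 *)

theory Defs
  imports
    "HOL-Analysis.Analysis"
    "HOL-Combinatorics.Permutations"
    "Jordan_Normal_Form.Determinant"
begin

section \<open>Smooth functions on open subsets of \<open>\<real>\<^sup>N\<close>\<close>

text \<open>
  \<open>\<real>\<^sup>N\<close> is the library's \<^const>\<open>Euclidean_space\<close> \<open>N\<close>: functions \<open>nat \<Rightarrow> real\<close> vanishing
  at all indices \<open>\<ge> N\<close>. Coordinates are therefore numbered from \<open>0\<close>, and the
  dimension \<open>0\<close> is allowed (so that Lie groups, whose base is a point, are Lie groupoids).
\<close>

definition partial :: "nat \<Rightarrow> ((nat \<Rightarrow> real) \<Rightarrow> 'b::real_normed_vector) \<Rightarrow> (nat \<Rightarrow> real) \<Rightarrow> 'b" where
  "partial i f p = vector_derivative (\<lambda>t. f (p(i := t))) (at (p i))"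

primrec Ck_on :: "nat \<Rightarrow> nat \<Rightarrow> (nat \<Rightarrow> real) set \<Rightarrow> ((nat \<Rightarrow> real) \<Rightarrow> 'b::real_normed_vector) \<Rightarrow> bool" where
  "Ck_on 0 N U f \<longleftrightarrow> continuous_map (subtopology (Euclidean_space N) U) euclidean f"
| "Ck_on (Suc k) N U f \<longleftrightarrow>
     continuous_map (subtopology (Euclidean_space N) U) euclidean f \<and>
     (\<forall>i<N. (\<forall>p\<in>U. (\<lambda>t. f (p(i := t))) differentiable (at (p i))) \<and> Ck_on k N U (partial i f))"

definition smooth_on :: "nat \<Rightarrow> (nat \<Rightarrow> real) set \<Rightarrow> ((nat \<Rightarrow> real) \<Rightarrow> 'b::real_normed_vector) \<Rightarrow> bool" where
  "smooth_on N U f \<longleftrightarrow> openin (Euclidean_space N) U \<and> (\<forall>k. Ck_on k N U f)"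

text \<open>Mixed partial derivative with multi-index \<open>\<alpha>\<close>, and the Taylor polynomial of total
  degree \<open>d\<close> at \<open>p\<close> of a function on \<open>\<real>\<^sup>N\<close>, evaluated at \<open>z\<close>.\<close>

definition multi_partial ::
    "nat \<Rightarrow> (nat \<Rightarrow> nat) \<Rightarrow> ((nat \<Rightarrow> real) \<Rightarrow> 'b::real_normed_vector) \<Rightarrow> (nat \<Rightarrow> real) \<Rightarrow> 'b" where
  "multi_partial N \<alpha> f = foldr (\<lambda>r. partial r ^^ \<alpha> r) [0..<N] f"

definition taylor_poly ::
    "nat \<Rightarrow> nat \<Rightarrow> ((nat \<Rightarrow> real) \<Rightarrow> complex) \<Rightarrow> (nat \<Rightarrow> real) \<Rightarrow> (nat \<Rightarrow> real) \<Rightarrow> complex" where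
  "taylor_poly N d f p z =
     (\<Sum>\<alpha> | (\<forall>r\<ge>N. \<alpha> r = 0) \<and> (\<Sum>r<N. \<alpha> r) \<le> d.
        multi_partial N \<alpha> f p / of_nat (\<Prod>r<N. fact (\<alpha> r)) *
        of_real (\<Prod>r<N. (z r - p r) ^ \<alpha> r))"

section \<open>Smooth manifolds\<close>

text \<open>An atlas is a set of pairs of a domain and a coordinate map; it need not be maximal.\<close>

record 'a manifold =
  mtop :: "'a topology"
  mdim :: nat
  atlas :: "('a set \<times> ('a \<Rightarrow> nat \<Rightarrow> real)) set"

definition is_chart :: "'a manifold \<Rightarrow> 'a set \<Rightarrow> ('a \<Rightarrow> nat \<Rightarrow> real) \<Rightarrow> bool" where
  "is_chart M U \<phi> \<longleftrightarrow>
     openin (mtop M) U \<and> openin (Euclidean_space (mdim M)) (\<phi> ` U) \<and>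
     homeomorphic_map (subtopology (mtop M) U) (subtopology (Euclidean_space (mdim M)) (\<phi> ` U)) \<phi>"

definition smooth_manifold :: "'a manifold \<Rightarrow> bool" where
  "smooth_manifold M \<longleftrightarrow>
     Hausdorff_space (mtop M) \<and> second_countable (mtop M) \<and>
     (\<forall>(U, \<phi>)\<in>atlas M. is_chart M U \<phi>) \<and>
     (\<Union>(U, \<phi>)\<in>atlas M. U) = topspace (mtop M) \<and>
     (\<forall>(U, \<phi>)\<in>atlas M. \<forall>(V, \<psi>)\<in>atlas M. \<forall>i<mdim M.
        smooth_on (mdim M) (\<phi> ` (U \<inter> V)) (\<lambda>q. \<psi> (inv_into U \<phi> q) i))"

definition euclidean_manifold :: "nat \<Rightarrow> (nat \<Rightarrow> real) manifold" where
  "euclidean_manifold N =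
     \<lparr>mtop = Euclidean_space N, mdim = N, atlas = {(topspace (Euclidean_space N), \<lambda>q. q)}\<rparr>"

text \<open>
  The power \<open>M\<^sup>n\<close>. Points are extensional functions on \<open>{..<n}\<close>, and \<open>n\<close> blocks of \<open>k\<close> real
  coordinates are concatenated: coordinate \<open>i\<close> of the \<open>j\<close>-th factor has index \<open>j * k + i\<close>.
\<close>

definition concat_blocks :: "nat \<Rightarrow> nat \<Rightarrow> (nat \<Rightarrow> nat \<Rightarrow> real) \<Rightarrow> nat \<Rightarrow> real" where
  "concat_blocks n k v = (\<lambda>r. if r < n * k then v (r div k) (r mod k) else 0)"

definition power_coords :: "nat \<Rightarrow> nat \<Rightarrow> (nat \<Rightarrow> 'a \<Rightarrow> nat \<Rightarrow> real) \<Rightarrow> (nat \<Rightarrow> 'a) \<Rightarrow> nat \<Rightarrow> real" where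
  "power_coords n k \<phi> p = concat_blocks n k (\<lambda>j. \<phi> j (p j))"

definition power_manifold :: "'a manifold \<Rightarrow> nat \<Rightarrow> (nat \<Rightarrow> 'a) manifold" where
  "power_manifold M n =
     \<lparr>mtop = product_topology (\<lambda>_. mtop M) {..<n},
      mdim = n * mdim M,
      atlas = {(Pi\<^sub>E {..<n} (\<lambda>j. fst (c j)), power_coords n (mdim M) (\<lambda>j. snd (c j))) | c.
                 \<forall>j<n. c j \<in> atlas M}\<rparr>"

section \<open>Smooth maps\<close>

definition smooth_fun :: "'a manifold \<Rightarrow> 'a set \<Rightarrow> ('a \<Rightarrow> 'b::real_normed_vector) \<Rightarrow> bool" where
  "smooth_fun M W f \<longleftrightarrow>
     openin (mtop M) W \<and>
     (\<forall>(U, \<phi>)\<in>atlas M. smooth_on (mdim M) (\<phi> ` (W \<inter> U)) (\<lambda>q. f (inv_into U \<phi> q)))"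

definition smooth_map :: "'a manifold \<Rightarrow> 'b manifold \<Rightarrow> 'a set \<Rightarrow> ('a \<Rightarrow> 'b) \<Rightarrow> bool" where
  "smooth_map M N W f \<longleftrightarrow>
     openin (mtop M) W \<and> continuous_map (subtopology (mtop M) W) (mtop N) f \<and>
     (\<forall>(V, \<psi>)\<in>atlas N. \<forall>i<mdim N. smooth_fun M {p \<in> W. f p \<in> V} (\<lambda>p. \<psi> (f p) i))"

text \<open>
  Smoothness on an arbitrary subset \<open>A\<close> of \<open>M\<close> means locally extending to a smooth map on an
  open subset of \<open>M\<close>. All subsets to which this is applied below (source fibers, sets of
  composable arrows, sets of arrows with common source) are embedded submanifolds,
  for which this is the same as smoothness with respect to the submanifold structure.
\<close>

definition smooth_fun_on :: "'a manifold \<Rightarrow> 'a set \<Rightarrow> ('a \<Rightarrow> 'b::real_normed_vector) \<Rightarrow> bool" where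
  "smooth_fun_on M A f \<longleftrightarrow>
     (\<forall>p\<in>A. \<exists>W F. p \<in> W \<and> smooth_fun M W F \<and> (\<forall>q\<in>W \<inter> A. F q = f q))"

definition smooth_map_on :: "'a manifold \<Rightarrow> 'b manifold \<Rightarrow> 'a set \<Rightarrow> ('a \<Rightarrow> 'b) \<Rightarrow> bool" where
  "smooth_map_on M N A f \<longleftrightarrow>
     (\<forall>p\<in>A. \<exists>W F. p \<in> W \<and> smooth_map M N W F \<and> (\<forall>q\<in>W \<inter> A. F q = f q))"

text \<open>The differential, i.e. the Jacobian matrix in charts, is surjective at every point.\<close>

definition submersion :: "'a manifold \<Rightarrow> 'b manifold \<Rightarrow> ('a \<Rightarrow> 'b) \<Rightarrow> bool" where
  "submersion M N f \<longleftrightarrow>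
     smooth_map M N (topspace (mtop M)) f \<and>
     (\<forall>p\<in>topspace (mtop M). \<forall>(U, \<phi>)\<in>atlas M. \<forall>(V, \<psi>)\<in>atlas N. p \<in> U \<longrightarrow> f p \<in> V \<longrightarrow>
        (\<forall>w :: nat \<Rightarrow> real. \<exists>v :: nat \<Rightarrow> real. \<forall>i<mdim N.
           w i = (\<Sum>j<mdim M. partial j (\<lambda>q. \<psi> (f (inv_into U \<phi> q)) i) (\<phi> p) * v j)))"

text \<open>
  \<open>(U, y)\<close> is a system of local coordinates \<open>y = (y\<^sup>0, \<dots>, y\<^sup>m\<^sup>-\<^sup>1)\<close> on the embedded
  submanifold \<open>S\<close> of \<open>M\<close>: a diffeomorphism from an open subset \<open>U\<close> of \<open>S\<close> onto an open
  subset of \<open>\<real>\<^sup>m\<close>.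
\<close>

definition local_coordinates ::
    "'a manifold \<Rightarrow> 'a set \<Rightarrow> nat \<Rightarrow> 'a set \<Rightarrow> ('a \<Rightarrow> nat \<Rightarrow> real) \<Rightarrow> bool" where
  "local_coordinates M S m U y \<longleftrightarrow>
     openin (subtopology (mtop M) S) U \<and> openin (Euclidean_space m) (y ` U) \<and> inj_on y U \<and>
     smooth_map_on M (euclidean_manifold m) U y \<and>
     smooth_map_on (euclidean_manifold m) M (y ` U) (inv_into U y)"

text \<open>
  Tangent vectors to the submanifold \<open>S\<close> at \<open>p\<close>: derivations of the algebra of germs at
  \<open>p\<close> of real-valued smooth functions on \<open>S\<close>. A derivation is represented by a functional on
  all functions; its values on functions not smooth near \<open>p\<close> carry no meaning.
\<close>

definition smooth_near :: "'a manifold \<Rightarrow> 'a set \<Rightarrow> 'a \<Rightarrow> ('a \<Rightarrow> real) \<Rightarrow> bool" where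
  "smooth_near M S p f \<longleftrightarrow> (\<exists>U. openin (subtopology (mtop M) S) U \<and> p \<in> U \<and> smooth_fun_on M U f)"

definition tangent_space :: "'a manifold \<Rightarrow> 'a set \<Rightarrow> 'a \<Rightarrow> (('a \<Rightarrow> real) \<Rightarrow> real) set" where
  "tangent_space M S p =
     {V. (\<forall>f g. smooth_near M S p f \<and> smooth_near M S p g \<longrightarrow>
            V (\<lambda>h. f h + g h) = V f + V g \<and>
            V (\<lambda>h. f h * g h) = f p * V g + g p * V f) \<and>
         (\<forall>f c. smooth_near M S p f \<longrightarrow> V (\<lambda>h. c * f h) = c * V f) \<and>
         (\<forall>f g U. smooth_near M S p f \<and> openin (subtopology (mtop M) S) U \<and> p \<in> U \<and>
            (\<forall>h\<in>U. f h = g h) \<longrightarrow> V f = V g)}"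

definition coord_vector ::
    "'a set \<Rightarrow> ('a \<Rightarrow> nat \<Rightarrow> real) \<Rightarrow> 'a \<Rightarrow> nat \<Rightarrow> ('a \<Rightarrow> real) \<Rightarrow> real" where
  "coord_vector U y p i f = partial i (\<lambda>q. f (inv_into U y q)) (y p)"

section \<open>Lie groupoids\<close>

record ('g, 'x) groupoid_data =
  arrows :: "'g manifold"
  objects :: "'x manifold"
  src :: "'g \<Rightarrow> 'x"
  tgt :: "'g \<Rightarrow> 'x"
  comp :: "'g \<Rightarrow> 'g \<Rightarrow> 'g"
  idn :: "'x \<Rightarrow> 'g"
  inverse_arrow :: "'g \<Rightarrow> 'g"

abbreviation Arr :: "('g, 'x) groupoid_data \<Rightarrow> 'g set" where
  "Arr \<Gamma> \<equiv> topspace (mtop (arrows \<Gamma>))"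

abbreviation Obj :: "('g, 'x) groupoid_data \<Rightarrow> 'x set" where
  "Obj \<Gamma> \<equiv> topspace (mtop (objects \<Gamma>))"

text \<open>The composition \<open>g h\<close> is defined when \<open>t(g) = s(h)\<close>.\<close>

definition groupoid :: "('g, 'x) groupoid_data \<Rightarrow> bool" where
  "groupoid \<Gamma> \<longleftrightarrow>
     (\<forall>g\<in>Arr \<Gamma>. src \<Gamma> g \<in> Obj \<Gamma> \<and> tgt \<Gamma> g \<in> Obj \<Gamma>) \<and>
     (\<forall>x\<in>Obj \<Gamma>. idn \<Gamma> x \<in> Arr \<Gamma> \<and> src \<Gamma> (idn \<Gamma> x) = x \<and> tgt \<Gamma> (idn \<Gamma> x) = x) \<and>
     (\<forall>g\<in>Arr \<Gamma>. \<forall>h\<in>Arr \<Gamma>. tgt \<Gamma> g = src \<Gamma> h \<longrightarrow>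
        comp \<Gamma> g h \<in> Arr \<Gamma> \<and> src \<Gamma> (comp \<Gamma> g h) = src \<Gamma> g \<and> tgt \<Gamma> (comp \<Gamma> g h) = tgt \<Gamma> h) \<and>
     (\<forall>g\<in>Arr \<Gamma>. \<forall>h\<in>Arr \<Gamma>. \<forall>k\<in>Arr \<Gamma>. tgt \<Gamma> g = src \<Gamma> h \<longrightarrow> tgt \<Gamma> h = src \<Gamma> k \<longrightarrow>
        comp \<Gamma> (comp \<Gamma> g h) k = comp \<Gamma> g (comp \<Gamma> h k)) \<and>
     (\<forall>g\<in>Arr \<Gamma>. comp \<Gamma> (idn \<Gamma> (src \<Gamma> g)) g = g \<and> comp \<Gamma> g (idn \<Gamma> (tgt \<Gamma> g)) = g) \<and>
     (\<forall>g\<in>Arr \<Gamma>. inverse_arrow \<Gamma> g \<in> Arr \<Gamma> \<and>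
        src \<Gamma> (inverse_arrow \<Gamma> g) = tgt \<Gamma> g \<and> tgt \<Gamma> (inverse_arrow \<Gamma> g) = src \<Gamma> g \<and>
        comp \<Gamma> g (inverse_arrow \<Gamma> g) = idn \<Gamma> (src \<Gamma> g) \<and>
        comp \<Gamma> (inverse_arrow \<Gamma> g) g = idn \<Gamma> (tgt \<Gamma> g))"

text \<open>Surjectivity of \<^const>\<open>src\<close> and \<^const>\<open>tgt\<close> follows from the unit axioms.\<close>

definition lie_groupoid :: "('g, 'x) groupoid_data \<Rightarrow> bool" where
  "lie_groupoid \<Gamma> \<longleftrightarrow>
     groupoid \<Gamma> \<and> smooth_manifold (arrows \<Gamma>) \<and> smooth_manifold (objects \<Gamma>) \<and>
     submersion (arrows \<Gamma>) (objects \<Gamma>) (src \<Gamma>) \<and>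
     submersion (arrows \<Gamma>) (objects \<Gamma>) (tgt \<Gamma>) \<and>
     smooth_map_on (power_manifold (arrows \<Gamma>) 2) (arrows \<Gamma>)
       {p \<in> Pi\<^sub>E {..<2} (\<lambda>_. Arr \<Gamma>). tgt \<Gamma> (p 0) = src \<Gamma> (p 1)} (\<lambda>p. comp \<Gamma> (p 0) (p 1)) \<and>
     smooth_map (objects \<Gamma>) (arrows \<Gamma>) (Obj \<Gamma>) (idn \<Gamma>) \<and>
     smooth_map (arrows \<Gamma>) (arrows \<Gamma>) (Arr \<Gamma>) (inverse_arrow \<Gamma>)"

definition source_fiber :: "('g, 'x) groupoid_data \<Rightarrow> 'x \<Rightarrow> 'g set" where
  "source_fiber \<Gamma> x = {g \<in> Arr \<Gamma>. src \<Gamma> g = x}"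

definition algebroid_fiber :: "('g, 'x) groupoid_data \<Rightarrow> 'x \<Rightarrow> (('g \<Rightarrow> real) \<Rightarrow> real) set" where
  "algebroid_fiber \<Gamma> x = tangent_space (arrows \<Gamma>) (source_fiber \<Gamma> x) (idn \<Gamma> x)"

section \<open>Cochains and the van Est map\<close>

text \<open>The space \<open>G\<^sup>(\<^sup>n\<^sup>)\<close> of \<open>n\<close>-tuples of arrows with common source.\<close>

definition common_source :: "('g, 'x) groupoid_data \<Rightarrow> nat \<Rightarrow> (nat \<Rightarrow> 'g) set" where
  "common_source \<Gamma> n =
     {g \<in> Pi\<^sub>E {..<n} (\<lambda>_. Arr \<Gamma>). \<forall>j<n. \<forall>k<n. src \<Gamma> (g j) = src \<Gamma> (g k)}"

definition cochain :: "('g, 'x) groupoid_data \<Rightarrow> nat \<Rightarrow> ((nat \<Rightarrow> 'g) \<Rightarrow> complex) \<Rightarrow> bool" where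
  "cochain \<Gamma> n \<Omega> \<longleftrightarrow> smooth_fun_on (power_manifold (arrows \<Gamma>) n) (common_source \<Gamma> n) \<Omega>"

definition normalized :: "('g, 'x) groupoid_data \<Rightarrow> nat \<Rightarrow> ((nat \<Rightarrow> 'g) \<Rightarrow> complex) \<Rightarrow> bool" where
  "normalized \<Gamma> n \<Omega> \<longleftrightarrow>
     (\<forall>g\<in>common_source \<Gamma> n. (\<exists>j<n. g j \<in> idn \<Gamma> ` Obj \<Gamma>) \<longrightarrow> \<Omega> g = 0)"

definition antisymmetric :: "('g, 'x) groupoid_data \<Rightarrow> nat \<Rightarrow> ((nat \<Rightarrow> 'g) \<Rightarrow> complex) \<Rightarrow> bool" where
  "antisymmetric \<Gamma> n \<Omega> \<longleftrightarrow>
     (\<forall>\<sigma>. \<sigma> permutes {..<n} \<longrightarrow>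
        (\<forall>g\<in>common_source \<Gamma> n. \<Omega> (\<lambda>j. g (\<sigma> j)) = of_int (sign \<sigma>) * \<Omega> g))"

definition Alt :: "nat \<Rightarrow> ((nat \<Rightarrow> 'g) \<Rightarrow> complex) \<Rightarrow> (nat \<Rightarrow> 'g) \<Rightarrow> complex" where
  "Alt n \<Omega> g = 1 / fact n * (\<Sum>\<sigma> | \<sigma> permutes {..<n}. of_int (sign \<sigma>) * \<Omega> (\<lambda>j. g (\<sigma> j)))"

definition complexify :: "(('g \<Rightarrow> real) \<Rightarrow> real) \<Rightarrow> ('g \<Rightarrow> complex) \<Rightarrow> complex" where
  "complexify V f = Complex (V (\<lambda>h. Re (f h))) (V (\<lambda>h. Im (f h)))"

text \<open>\<open>iterated_derivative V n F\<close> is \<open>V\<^sub>0 \<cdots> V\<^sub>n\<^sub>-\<^sub>1 F\<close>, with \<open>V\<^sub>j\<close> acting on the \<open>j\<close>-th argument;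
  the last vector is applied first.\<close>

primrec iterated_derivative ::
    "(nat \<Rightarrow> ('g \<Rightarrow> real) \<Rightarrow> real) \<Rightarrow> nat \<Rightarrow> ((nat \<Rightarrow> 'g) \<Rightarrow> complex) \<Rightarrow> complex" where
  "iterated_derivative V 0 F = F (\<lambda>_. undefined)"
| "iterated_derivative V (Suc n) F =
     iterated_derivative V n (\<lambda>g. complexify (V n) (\<lambda>h. F (g(n := h))))"

definition van_Est ::
    "nat \<Rightarrow> ((nat \<Rightarrow> 'g) \<Rightarrow> complex) \<Rightarrow> (nat \<Rightarrow> ('g \<Rightarrow> real) \<Rightarrow> real) \<Rightarrow> complex" where
  "van_Est n \<Omega> V = fact n * iterated_derivative V n (Alt n \<Omega>)"

text \<open>The determinant of the vectors \<open>v\<^sub>0 - x, \<dots>, v\<^sub>n\<^sub>-\<^sub>1 - x\<close> in \<open>\<real>\<^sup>n\<close>.\<close>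

definition Vol_simplex :: "nat \<Rightarrow> (nat \<Rightarrow> real) \<Rightarrow> (nat \<Rightarrow> nat \<Rightarrow> real) \<Rightarrow> real" where
  "Vol_simplex n x v = Determinant.det (Matrix.mat n n (\<lambda>(a, b). v a b - x b))"

end

theory Submission
  imports Defs
begin

text \<open>
  In the coordinates induced by \<open>y\<close> the cochain is a function \<open>f\<close> of \<open>n\<close> blocks of \<open>m\<close> real
  variables, smooth near the point \<open>P\<close> all of whose blocks are the coordinates of the identity
  arrow. Normalization says that \<open>f\<close> vanishes as soon as one block equals that of \<open>P\<close>, so a partial
  derivative of \<open>f\<close> vanishes at \<open>P\<close> unless it differentiates in every block
  (\<open>foldr_partial_vanish\<close>). In total order at most \<open>n\<close> this leaves only the derivatives that
  differentiate exactly once in each block (\<open>taylor_poly_one_per_block\<close>): the Taylor polynomial is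
  the sum of \<open>c i * (\<Prod>a<n. z a (i a) - y p (i a))\<close> over all \<open>i\<close> from \<open>{..<n}\<close> to \<open>{..<m}\<close>, where
  \<open>p\<close> is the identity arrow and \<open>c i\<close> differentiates the block \<open>a\<close> in the direction \<open>i a\<close>.
  Antisymmetry of the cochain and the symmetry of mixed partial derivatives make \<open>c\<close> antisymmetric
  under permutations of the blocks (\<open>foldr_partial_permute_blocks\<close>). So \<open>c i\<close> vanishes when \<open>i\<close> is
  not injective, and collecting the injective \<open>i\<close> with the same image turns the sum into a sum of
  determinants over increasing \<open>i\<close> (\<open>sum_antisymmetric_eq_sum_det\<close>). Finally \<open>c i\<close> is, up to the
  factor \<open>n!\<close>, the value of the van Est map on the coordinate vectors
  (\<open>iterated_derivative_eq_foldr_partial\<close>), because alternation does not change an antisymmetric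
  cochain.

  Smoothness of \<open>f\<close> has to be extracted from smoothness in charts of the arrow manifold, which
  differ from the given coordinates. This needs the chain rule for functions with continuous partial
  derivatives (\<open>chain_rule_curve\<close>, \<open>Ck_on_compose\<close>); symmetry of mixed partial derivatives is
  \<open>partial_commute\<close>. That the coordinate vectors are derivations on germs
  (\<open>coord_vector_in_tangent_space\<close>) follows in the same way from smoothness of germs in the given
  coordinates.
\<close>

section \<open>Calculus with coordinate partial derivatives\<close>

lemma openin_Euclidean_eq:
  "openin (Euclidean_space N) U \<longleftrightarrow> openin (top_of_set {x. \<forall>i\<ge>N. x i = 0}) U"
  by (simp add: Euclidean_space_def euclidean_product_topology)

lemma fun_upd_in_Euclidean:
  "p \<in> topspace (Euclidean_space N) \<Longrightarrow> i < N \<Longrightarrow> p(i := t) \<in> topspace (Euclidean_space N)"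
  by (auto simp: topspace_Euclidean_space)

text \<open>
  Cubes form a neighbourhood basis in \<^const>\<open>Euclidean_space\<close> \<open>N\<close>: the points of the space differ only
  in the finitely many coordinates below \<open>N\<close>, so one half-width serves all of them.
\<close>

lemma openin_Euclidean_box:
  assumes "openin (Euclidean_space N) U" and "p \<in> U"
  obtains d where "d > 0"
    and "\<And>q. q \<in> topspace (Euclidean_space N) \<Longrightarrow> (\<And>j. j < N \<Longrightarrow> \<bar>q j - p j\<bar> < d) \<Longrightarrow> q \<in> U"
proof -
  let ?E = "{x::nat \<Rightarrow> real. \<forall>i\<ge>N. x i = 0}"
  obtain T where T: "open T" "U = ?E \<inter> T"
    using assms(1) unfolding openin_Euclidean_eq openin_open by auto
  obtain X where X: "p \<in> Pi\<^sub>E UNIV X" "\<And>i. open (X i)" "Pi\<^sub>E UNIV X \<subseteq> T"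
    using product_topology_open_contains_basis[of "\<lambda>_. euclidean" UNIV T p] T assms(2)
    by (auto simp: open_fun_def)
  have "\<exists>d>0. \<forall>t. \<bar>t - p i\<bar> < d \<longrightarrow> t \<in> X i" for i
    using X(1) X(2)[of i] unfolding open_dist by (force simp: dist_real_def)
  then obtain \<delta> where \<delta>: "\<And>i. \<delta> i > 0" "\<And>i t. \<bar>t - p i\<bar> < \<delta> i \<Longrightarrow> t \<in> X i"
    by metis
  define d where "d = Min (insert 1 (\<delta> ` {..<N}))"
  have "d > 0" unfolding d_def using \<delta>(1) by (subst Min_gr_iff) auto
  moreover have "q \<in> U" if q: "q \<in> topspace (Euclidean_space N)" "\<And>j. j < N \<Longrightarrow> \<bar>q j - p j\<bar> < d" for q
  proof -
    have "q i \<in> X i" for i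
    proof (cases "i < N")
      case True
      then have "d \<le> \<delta> i" unfolding d_def by (intro Min_le) auto
      with q(2)[OF True] show ?thesis by (intro \<delta>(2)) linarith
    next
      case False
      then have "q i = p i" using q(1) assms(2) T by (auto simp: topspace_Euclidean_space)
      then show ?thesis using X(1) by auto
    qed
    then have "q \<in> Pi\<^sub>E UNIV X" by auto
    then show ?thesis using X(3) T q(1) by (auto simp: topspace_Euclidean_space)
  qed
  ultimately show ?thesis using that by blast
qed

lemma eventually_update_in_open:
  assumes "openin (Euclidean_space N) U" and "p \<in> U" and "i < N"
  shows "eventually (\<lambda>t. p(i := t) \<in> U) (nhds (p i))"
proof -
  obtain d where d: "d > 0"
    "\<And>q. q \<in> topspace (Euclidean_space N) \<Longrightarrow> (\<And>j. j < N \<Longrightarrow> \<bar>q j - p j\<bar> < d) \<Longrightarrow> q \<in> U"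
    using openin_Euclidean_box[OF assms(1,2)] by metis
  have p: "p \<in> topspace (Euclidean_space N)"
    using assms openin_subset by blast
  have "p(i := t) \<in> U" if "dist t (p i) < d" for t
    using that d(1) by (intro d(2) fun_upd_in_Euclidean p assms) (auto simp: dist_real_def)
  then show ?thesis using d(1) unfolding eventually_nhds_metric by blast
qed

lemma partial_cong_ev:
  assumes "eventually (\<lambda>t. f (p(i := t)) = g (p(i := t))) (nhds (p i))"
  shows "partial i f p = partial i g p"
  unfolding partial_def
  by (rule vector_derivative_cong_eq) (use assms in auto)

lemma differentiable_cong_ev:
  fixes f g :: "real \<Rightarrow> 'b::real_normed_vector"
  assumes "eventually (\<lambda>t. f t = g t) (nhds a)" and "f differentiable (at a)"
  shows "g differentiable (at a)"
proof -
  have "f a = g a" using assms(1) eventually_nhds_x_imp_x by fastforce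
  then show ?thesis using assms
    unfolding differentiable_def
    by (metis has_derivative_transform_eventually eventually_nhds_conv_at UNIV_I)
qed

lemma partial_cong:
  assumes "openin (Euclidean_space N) U" and "p \<in> U" and "i < N" and "\<And>q. q \<in> U \<Longrightarrow> f q = g q"
  shows "partial i f p = partial i g p"
  by (rule partial_cong_ev, rule eventually_mono[OF eventually_update_in_open[OF assms(1-3)]])
     (use assms in auto)

lemma continuous_map_Euclidean_subset:
  assumes "U \<subseteq> topspace (Euclidean_space N)"
  shows "continuous_map (subtopology (Euclidean_space N) U) euclidean f \<longleftrightarrow> continuous_on U f"
proof -
  have "subtopology (Euclidean_space N) U = top_of_set U"
    using assms
    by (simp add: Euclidean_space_def euclidean_product_topology subtopology_subtopology
        topspace_Euclidean_space Int_absorb1)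
  then show ?thesis by simp
qed

text \<open>
  Partial derivatives at a point of an open set see only the values on that set, so \<^const>\<open>Ck_on\<close>
  does not depend on the values of the function elsewhere.
\<close>

lemma Ck_on_cong:
  assumes "openin (Euclidean_space N) U" and "\<And>q. q \<in> U \<Longrightarrow> f q = g q" and "Ck_on k N U f"
  shows "Ck_on k N U g"
  using assms(2,3)
proof (induction k arbitrary: f g)
  case 0
  then show ?case
    using continuous_map_eq[of "subtopology (Euclidean_space N) U" euclidean f g] by auto
next
  case (Suc k)
  have 1: "(\<lambda>t. g (p(i := t))) differentiable (at (p i))" if "i < N" "p \<in> U" for i p
  proof (rule differentiable_cong_ev)
    show "\<forall>\<^sub>F t in nhds (p i). f (p(i := t)) = g (p(i := t))"
      by (rule eventually_mono[OF eventually_update_in_open[OF assms(1) that(2,1)]])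
         (use Suc.prems in auto)
    show "(\<lambda>t. f (p(i := t))) differentiable (at (p i))" using Suc.prems that by auto
  qed
  have 2: "Ck_on k N U (partial i g)" if "i < N" for i
  proof (rule Suc.IH)
    show "Ck_on k N U (partial i f)" using Suc.prems that by auto
    show "partial i f q = partial i g q" if "q \<in> U" for q
      using partial_cong[OF assms(1) that \<open>i < N\<close>] Suc.prems(1) by metis
  qed
  from 1 2 Suc.prems show ?case
    using continuous_map_eq[of "subtopology (Euclidean_space N) U" euclidean f g] by auto
qed

lemma Ck_on_subset:
  assumes "V \<subseteq> U" and "Ck_on k N U f"
  shows "Ck_on k N V f"
  using assms(2)
proof (induction k arbitrary: f)
  case 0
  then show ?case using continuous_map_from_subtopology_mono assms(1) by auto
next
  case (Suc k)
  then show ?case using continuous_map_from_subtopology_mono assms(1) by auto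
qed

lemma Ck_on_SucD:
  "Ck_on (Suc k) N U f \<Longrightarrow> Ck_on k N U f"
proof (induction k arbitrary: f)
  case (Suc k)
  then show ?case by (auto simp del: Ck_on.simps(1))
qed auto

lemma Ck_on_continuous:
  assumes "openin (Euclidean_space N) U" and "Ck_on k N U f"
  shows "continuous_on U f"
  using assms continuous_map_Euclidean_subset[OF openin_subset[OF assms(1)]]
  by (cases k) auto

lemma Ck_on_Suc_iff:
  assumes "openin (Euclidean_space N) U"
  shows "Ck_on (Suc k) N U f \<longleftrightarrow> continuous_on U f \<and>
     (\<forall>i<N. (\<forall>p\<in>U. (\<lambda>t. f (p(i := t))) differentiable (at (p i))) \<and> Ck_on k N U (partial i f))"
  using continuous_map_Euclidean_subset[OF openin_subset[OF assms(1)]] by auto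

lemma Ck_on_0_iff:
  assumes "openin (Euclidean_space N) U"
  shows "Ck_on 0 N U f \<longleftrightarrow> continuous_on U f"
  using continuous_map_Euclidean_subset[OF openin_subset[OF assms(1)]] by auto

text \<open>
  The point at which the derivative is taken is written \<open>p(i := s)\<close>, so that \<open>s\<close> can run through
  a segment in the mean value estimates below.
\<close>

lemma has_partial:
  assumes "openin (Euclidean_space N) U" "Ck_on (Suc k) N U f" "i < N" "p(i := s) \<in> U"
  shows "((\<lambda>t. f (p(i := t))) has_vector_derivative partial i f (p(i := s))) (at s within T)"
proof -
  have "(\<lambda>t. f (p(i := s, i := t))) differentiable (at ((p(i := s)) i))"
    using assms unfolding Ck_on_Suc_iff[OF assms(1)] by blast
  then have "((\<lambda>t. f (p(i := t))) has_vector_derivative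
       vector_derivative (\<lambda>t. f (p(i := s, i := t))) (at ((p(i := s)) i))) (at s)"
    by (simp add: vector_derivative_works)
  then show ?thesis unfolding partial_def
    by (rule has_vector_derivative_at_within)
qed

declare Ck_on.simps [simp del]

lemma has_partial_at:
  assumes "openin (Euclidean_space N) U" "Ck_on (Suc k) N U f" "i < N" "p \<in> U"
  shows "((\<lambda>t. f (p(i := t))) has_vector_derivative partial i f p) (at (p i))"
  using has_partial[OF assms(1-3), of p "p i"] assms(4) by simp

lemma Ck_on_partial: "Ck_on (Suc k) N U f \<Longrightarrow> i < N \<Longrightarrow> Ck_on k N U (partial i f)"
  by (simp add: Ck_on.simps)

lemma vector_derivative_bound:
  fixes \<phi> :: "real \<Rightarrow> 'b::real_normed_vector"
  assumes "\<And>s. s \<in> closed_segment a b \<Longrightarrow> (\<phi> has_vector_derivative \<phi>' s) (at s within closed_segment a b)"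
    and "\<And>s. s \<in> closed_segment a b \<Longrightarrow> norm (\<phi>' s) \<le> B"
  shows "norm (\<phi> b - \<phi> a) \<le> B * \<bar>b - a\<bar>"
proof -
  have "norm (\<phi> b - \<phi> a) \<le> B * norm (b - a)"
  proof (rule differentiable_bound)
    show "convex (closed_segment a b)" by simp
    show "(\<phi> has_derivative (\<lambda>h. h *\<^sub>R \<phi>' s)) (at s within closed_segment a b)"
      if "s \<in> closed_segment a b" for s
      using assms(1)[OF that] by (simp add: has_vector_derivative_def)
    show "onorm (\<lambda>h. h *\<^sub>R \<phi>' s) \<le> B" if "s \<in> closed_segment a b" for s
      by (rule onorm_le) (use assms(2)[OF that] in \<open>simp add: mult.commute[of B] mult_left_mono\<close>)
  qed auto
  then show ?thesis by simp
qed

lemma openin_norm_diff_less: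
  fixes g :: "(nat \<Rightarrow> real) \<Rightarrow> 'b::real_normed_vector"
  assumes U: "openin (Euclidean_space N) U" and g: "continuous_on U g"
  shows "openin (Euclidean_space N) {q \<in> U. norm (g q - c) < e}"
proof -
  have "continuous_map (subtopology (Euclidean_space N) U) euclidean (\<lambda>q. norm (g q - c))"
    unfolding continuous_map_Euclidean_subset[OF openin_subset[OF U]]
    using g by (intro continuous_intros)
  then have "openin (subtopology (Euclidean_space N) U)
      {q \<in> topspace (subtopology (Euclidean_space N) U). norm (g q - c) \<in> {..<e}}"
    by (rule openin_continuous_map_preimage) simp
  moreover have "topspace (subtopology (Euclidean_space N) U) = U"
    using openin_subset[OF U] by auto
  ultimately show ?thesis using openin_trans_full U by fastforce
qed

text \<open>
  A function with continuous partial derivatives is differentiable: the error of the linear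
  approximation is small compared with the distance.
\<close>

lemma Ck_on_linearization:
  fixes f :: "(nat \<Rightarrow> real) \<Rightarrow> 'b::real_normed_vector"
  assumes U: "openin (Euclidean_space N) U" and f: "Ck_on (Suc k) N U f" and p: "p \<in> U" and e: "e > 0"
  shows "\<exists>d>0. \<forall>q\<in>topspace (Euclidean_space N). (\<forall>j<N. \<bar>q j - p j\<bar> < d) \<longrightarrow>
      norm (f q - f p - (\<Sum>j<N. (q j - p j) *\<^sub>R partial j f p)) \<le> e * (\<Sum>j<N. \<bar>q j - p j\<bar>)"
proof -
  let ?E = "topspace (Euclidean_space N)"
  define V where "V = {q \<in> U. \<forall>j<N. norm (partial j f q - partial j f p) < e}"
  have V: "openin (Euclidean_space N) V"
  proof -
    have "openin (Euclidean_space N) {q \<in> U. norm (partial j f q - partial j f p) < e}" if "j < N" for j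
      using openin_norm_diff_less[OF U Ck_on_continuous[OF U Ck_on_partial[OF f that]]] .
    then have "openin (Euclidean_space N)
        (\<Inter> (insert U ((\<lambda>j. {q \<in> U. norm (partial j f q - partial j f p) < e}) ` {..<N})))"
      using U by (intro openin_Inter) auto
    moreover have "\<Inter> (insert U ((\<lambda>j. {q \<in> U. norm (partial j f q - partial j f p) < e}) ` {..<N})) = V"
      unfolding V_def by auto
    ultimately show ?thesis by simp
  qed
  have "p \<in> V" using p e by (simp add: V_def)
  then obtain d where d: "d > 0"
    "\<And>q. q \<in> ?E \<Longrightarrow> (\<And>j. j < N \<Longrightarrow> \<bar>q j - p j\<bar> < d) \<Longrightarrow> q \<in> V"
    using openin_Euclidean_box[OF V] by metis
  have pE: "p \<in> ?E" using p openin_subset[OF U] by blast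
  have "norm (f q - f p - (\<Sum>j<N. (q j - p j) *\<^sub>R partial j f p)) \<le> e * (\<Sum>j<N. \<bar>q j - p j\<bar>)"
    if q: "q \<in> ?E" "\<And>j. j < N \<Longrightarrow> \<bar>q j - p j\<bar> < d" for q
  proof -
    \<comment> \<open>pass from \<open>p\<close> to \<open>q\<close> along the axes, changing one coordinate at a time\<close>
    define r where "r j = (\<lambda>i. if i < j then q i else p i)" for j
    have rN: "r N = q" using q(1) pE by (auto simp: r_def topspace_Euclidean_space fun_eq_iff)
    have r0: "r 0 = p" by (simp add: r_def)
    have step: "norm (f (r (Suc j)) - f (r j) - (q j - p j) *\<^sub>R partial j f p) \<le> \<bar>q j - p j\<bar> * e"
      if j: "j < N" for j
    proof -
      have upd: "r (Suc j) = (r j)(j := q j)" "r j = (r j)(j := p j)"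
        by (auto simp: r_def fun_eq_iff less_Suc_eq)
      have inV: "(r j)(j := s) \<in> V" if "s \<in> closed_segment (p j) (q j)" for s
      proof (rule d(2))
        show "(r j)(j := s) \<in> ?E"
          using q(1) pE j by (auto simp: r_def topspace_Euclidean_space)
        have "\<bar>s - p j\<bar> \<le> \<bar>q j - p j\<bar>"
          using that by (auto simp: closed_segment_eq_real_ivl split: if_splits)
        with q(2)[OF j] have "\<bar>s - p j\<bar> < d" by linarith
        then show "\<bar>((r j)(j := s)) i - p i\<bar> < d" if "i < N" for i
          using q(2) that d(1) by (auto simp: r_def)
      qed
      have "norm ((\<lambda>s. f ((r j)(j := s)) - s *\<^sub>R partial j f p) (q j)
                - (\<lambda>s. f ((r j)(j := s)) - s *\<^sub>R partial j f p) (p j)) \<le> e * \<bar>q j - p j\<bar>"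
      proof (rule vector_derivative_bound)
        fix s assume s: "s \<in> closed_segment (p j) (q j)"
        have "(r j)(j := s) \<in> U" using inV[OF s] by (simp add: V_def)
        note has_partial[OF U f j this, of "closed_segment (p j) (q j)"]
        then have "((\<lambda>s. f ((r j)(j := s)) - s *\<^sub>R partial j f p) has_vector_derivative
           partial j f ((r j)(j := s)) - (s *\<^sub>R 0 + 1 *\<^sub>R partial j f p)) (at s within closed_segment (p j) (q j))"
          by (intro derivative_intros) auto
        then show "((\<lambda>s. f ((r j)(j := s)) - s *\<^sub>R partial j f p) has_vector_derivative
           partial j f ((r j)(j := s)) - partial j f p) (at s within closed_segment (p j) (q j))"
          by simp
        show "norm (partial j f ((r j)(j := s)) - partial j f p) \<le> e"
          using inV[OF s] j by (auto simp: V_def less_imp_le)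
      qed
      then have A: "norm ((f (r (Suc j)) - q j *\<^sub>R partial j f p) - (f (r j) - p j *\<^sub>R partial j f p))
          \<le> e * \<bar>q j - p j\<bar>"
        using upd by simp
      have "(f (r (Suc j)) - q j *\<^sub>R partial j f p) - (f (r j) - p j *\<^sub>R partial j f p)
         = f (r (Suc j)) - f (r j) - (q j - p j) *\<^sub>R partial j f p"
        by (simp add: algebra_simps)
      from A[unfolded this] show ?thesis by (simp add: mult.commute)
    qed
    have "f q - f p - (\<Sum>j<N. (q j - p j) *\<^sub>R partial j f p)
        = (\<Sum>j<N. f (r (Suc j)) - f (r j) - (q j - p j) *\<^sub>R partial j f p)"
      unfolding sum_subtractf[of "\<lambda>j. f (r (Suc j)) - f (r j)"] sum_lessThan_telescope[of "\<lambda>j. f (r j)"] rN r0 ..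
    also have "norm \<dots> \<le> (\<Sum>j<N. \<bar>q j - p j\<bar> * e)"
      by (rule sum_norm_le) (use step in auto)
    finally show ?thesis by (simp add: sum_distrib_left mult.commute)
  qed
  then show ?thesis using d(1) by blast
qed

text \<open>
  The chain rule along a curve that is differentiable at a single parameter \<open>t\<close>.
\<close>

lemma chain_rule_curve:
  fixes f :: "(nat \<Rightarrow> real) \<Rightarrow> 'b::real_normed_vector" and \<gamma> :: "real \<Rightarrow> nat \<Rightarrow> real"
  assumes U: "openin (Euclidean_space N) U" and f: "Ck_on (Suc k) N U f" and p: "\<gamma> t \<in> U"
    and E: "eventually (\<lambda>s. \<gamma> s \<in> topspace (Euclidean_space N)) (nhds t)"
    and \<gamma>: "\<And>j. j < N \<Longrightarrow> ((\<lambda>s. \<gamma> s j) has_vector_derivative \<gamma>' j) (at t)"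
  shows "((\<lambda>s. f (\<gamma> s)) has_vector_derivative (\<Sum>j<N. \<gamma>' j *\<^sub>R partial j f (\<gamma> t))) (at t)"
proof -
  \<comment> \<open>\<open>R\<close> is the error of the linear approximation along \<open>\<gamma>\<close>; its derivative at \<open>t\<close> is zero\<close>
  define R where "R s = f (\<gamma> s) - f (\<gamma> t) - (\<Sum>j<N. (\<gamma> s j - \<gamma> t j) *\<^sub>R partial j f (\<gamma> t))" for s
  \<comment> \<open>near \<open>t\<close>, the coordinates of \<open>\<gamma>\<close> move by a total of at most \<open>C * \<bar>s - t\<bar>\<close>\<close>
  define C where "C = (\<Sum>j<N. \<bar>\<gamma>' j\<bar> + 1)"
  have C0: "C \<ge> 0" unfolding C_def by (intro sum_nonneg) auto
  have bnd: "\<exists>d>0. \<forall>s. \<bar>s - t\<bar> < d \<longrightarrow> \<bar>\<gamma> s j - \<gamma> t j\<bar> \<le> (\<bar>\<gamma>' j\<bar> + 1) * \<bar>s - t\<bar>" if j: "j < N" for j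
  proof -
    have "\<forall>e>0. \<exists>d>0. \<forall>s. norm (s - t) < d \<longrightarrow>
        norm (\<gamma> s j - \<gamma> t j - (s - t) *\<^sub>R \<gamma>' j) \<le> e * norm (s - t)"
      using \<gamma>[OF j] unfolding has_vector_derivative_def has_derivative_at_alt by blast
    then have "\<exists>d>0. \<forall>s. norm (s - t) < d \<longrightarrow>
        norm (\<gamma> s j - \<gamma> t j - (s - t) *\<^sub>R \<gamma>' j) \<le> 1 * norm (s - t)"
      by (rule allE[where x = 1]) simp
    then obtain d where d: "d > 0"
      "\<And>s. norm (s - t) < d \<Longrightarrow> norm (\<gamma> s j - \<gamma> t j - (s - t) *\<^sub>R \<gamma>' j) \<le> 1 * norm (s - t)"
      by blast
    have "\<bar>\<gamma> s j - \<gamma> t j\<bar> \<le> (\<bar>\<gamma>' j\<bar> + 1) * \<bar>s - t\<bar>" if "\<bar>s - t\<bar> < d" for s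
    proof -
      have "\<bar>\<gamma> s j - \<gamma> t j\<bar> \<le> \<bar>\<gamma> s j - \<gamma> t j - (s - t) * \<gamma>' j\<bar> + \<bar>(s - t) * \<gamma>' j\<bar>" by linarith
      also have "\<dots> \<le> \<bar>s - t\<bar> + \<bar>s - t\<bar> * \<bar>\<gamma>' j\<bar>" using d(2)[of s] that by (simp add: abs_mult)
      finally show ?thesis by (simp add: algebra_simps)
    qed
    then show ?thesis using d(1) by blast
  qed
  then obtain \<delta> where \<delta>: "\<And>j. j < N \<Longrightarrow> \<delta> j > 0"
    "\<And>j s. j < N \<Longrightarrow> \<bar>s - t\<bar> < \<delta> j \<Longrightarrow> \<bar>\<gamma> s j - \<gamma> t j\<bar> \<le> (\<bar>\<gamma>' j\<bar> + 1) * \<bar>s - t\<bar>"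
    by metis
  obtain d0 where d0: "d0 > 0" "\<And>s. \<bar>s - t\<bar> < d0 \<Longrightarrow> \<gamma> s \<in> topspace (Euclidean_space N)"
    using E unfolding eventually_nhds_metric dist_real_def by metis
  have R0: "R t = 0" by (simp add: R_def)
  have "(R has_vector_derivative 0) (at t)"
    unfolding has_vector_derivative_def has_derivative_at_alt
  proof (intro conjI allI impI)
    show "bounded_linear (\<lambda>h. h *\<^sub>R (0 :: 'b))" by simp
    fix e :: real assume e: "e > 0"
    define e' where "e' = e / (C + 1)"
    have e': "e' > 0" using e C0 by (simp add: e'_def)
    obtain d1 where d1: "d1 > 0"
      "\<And>q. q \<in> topspace (Euclidean_space N) \<Longrightarrow> (\<And>j. j < N \<Longrightarrow> \<bar>q j - \<gamma> t j\<bar> < d1) \<Longrightarrow>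
      norm (f q - f (\<gamma> t) - (\<Sum>j<N. (q j - \<gamma> t j) *\<^sub>R partial j f (\<gamma> t))) \<le> e' * (\<Sum>j<N. \<bar>q j - \<gamma> t j\<bar>)"
      using Ck_on_linearization[OF U f p e'] by blast
    define d where "d = Min (insert d0 (insert (d1 / (C + 1)) (\<delta> ` {..<N})))"
    have d: "d > 0" "d \<le> d0" "d \<le> d1 / (C + 1)" "\<And>j. j < N \<Longrightarrow> d \<le> \<delta> j"
    proof -
      have fin: "finite (insert d0 (insert (d1 / (C + 1)) (\<delta> ` {..<N})))" by simp
      show "d > 0" unfolding d_def using d0(1) d1(1) C0 \<delta>(1) by (subst Min_gr_iff) auto
      show "d \<le> d0" unfolding d_def by (rule Min_le[OF fin]) auto
      show "d \<le> d1 / (C + 1)" unfolding d_def by (rule Min_le[OF fin]) auto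
      show "d \<le> \<delta> j" if "j < N" for j unfolding d_def by (rule Min_le[OF fin]) (use that in auto)
    qed
    have "norm (R s - R t - (s - t) *\<^sub>R 0) \<le> e * norm (s - t)" if s: "norm (s - t) < d" for s
    proof -
      have b: "\<bar>\<gamma> s j - \<gamma> t j\<bar> \<le> (\<bar>\<gamma>' j\<bar> + 1) * \<bar>s - t\<bar>" if "j < N" for j
        using \<delta>(2)[OF that] d(4)[OF that] s by auto
      have "\<bar>\<gamma> s j - \<gamma> t j\<bar> < d1" if j: "j < N" for j
      proof -
        have "(\<bar>\<gamma>' j\<bar> + 1) \<le> C" unfolding C_def
          by (rule member_le_sum) (use j in auto)
        then have "(\<bar>\<gamma>' j\<bar> + 1) * \<bar>s - t\<bar> \<le> (C + 1) * \<bar>s - t\<bar>" by (intro mult_right_mono) auto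
        also have "\<dots> < (C + 1) * (d1 / (C + 1))" using s d(3) C0 by (intro mult_strict_left_mono) auto
        also have "\<dots> = d1" using C0 by simp
        finally show ?thesis using b[OF j] by linarith
      qed
      then have "norm (R s) \<le> e' * (\<Sum>j<N. \<bar>\<gamma> s j - \<gamma> t j\<bar>)"
        unfolding R_def using d1(2)[of "\<gamma> s"] d0(2)[of s] s d(2) by auto
      also have "\<dots> \<le> e' * (\<Sum>j<N. (\<bar>\<gamma>' j\<bar> + 1) * \<bar>s - t\<bar>)"
        using e' b by (intro mult_left_mono sum_mono) auto
      also have "\<dots> = e' * C * \<bar>s - t\<bar>"
        unfolding C_def sum_distrib_right[symmetric] by (simp add: mult.assoc)
      also have "\<dots> \<le> e * \<bar>s - t\<bar>"
        unfolding e'_def using C0 e by (intro mult_right_mono) (auto simp: field_simps)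
      finally show ?thesis using R0 by simp
    qed
    then show "\<exists>d>0. \<forall>s. norm (s - t) < d \<longrightarrow> norm (R s - R t - (s - t) *\<^sub>R 0) \<le> e * norm (s - t)"
      using d(1) by blast
  qed
  moreover have "((\<lambda>s. \<Sum>j<N. (\<gamma> s j - \<gamma> t j) *\<^sub>R partial j f (\<gamma> t)) has_vector_derivative
      (\<Sum>j<N. \<gamma>' j *\<^sub>R partial j f (\<gamma> t))) (at t)"
  proof (rule has_vector_derivative_sum)
    fix j assume "j \<in> {..<N}"
    then have "((\<lambda>s. \<gamma> s j) has_field_derivative \<gamma>' j) (at t)"
      using \<gamma> by (auto simp: has_real_derivative_iff_has_vector_derivative)
    then have "((\<lambda>s. \<gamma> s j - \<gamma> t j) has_field_derivative \<gamma>' j) (at t)"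
      by (auto intro!: derivative_eq_intros)
    from has_vector_derivative_scaleR[OF this has_vector_derivative_const]
    show "((\<lambda>s. (\<gamma> s j - \<gamma> t j) *\<^sub>R partial j f (\<gamma> t)) has_vector_derivative \<gamma>' j *\<^sub>R partial j f (\<gamma> t)) (at t)"
      by simp
  qed
  ultimately have "((\<lambda>s. R s + (\<Sum>j<N. (\<gamma> s j - \<gamma> t j) *\<^sub>R partial j f (\<gamma> t)) + f (\<gamma> t)) has_vector_derivative
      (0 + (\<Sum>j<N. \<gamma>' j *\<^sub>R partial j f (\<gamma> t)) + 0)) (at t)"
    by (intro has_vector_derivative_add has_vector_derivative_const)
  then show ?thesis by (simp add: R_def)
qed

lemma Ck_on_const:
  assumes "openin (Euclidean_space N) U"
  shows "Ck_on k N U (\<lambda>_. c)"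
proof (induction k arbitrary: c)
  case (Suc k)
  have "partial i (\<lambda>_. c) = (\<lambda>_. 0)" for i by (simp add: partial_def fun_eq_iff)
  then show ?case using Suc by (simp add: Ck_on.simps)
qed (simp add: Ck_on.simps)

lemma has_vector_derivative_coord:
  "((\<lambda>t. (p(i := t)) r) has_vector_derivative (if r = i then 1 else 0)) (at s :: real filter)"
  using has_vector_derivative_const[of "p r"] has_vector_derivative_id
  by (cases "r = i") auto

lemma Ck_on_coord:
  assumes U: "openin (Euclidean_space N) U"
  shows "Ck_on k N U (\<lambda>q. q r)"
proof -
  have c: "continuous_on U (\<lambda>q::nat \<Rightarrow> real. q r)"
    by (rule continuous_on_subset[OF continuous_on_product_coordinates]) simp
  show ?thesis
  proof (cases k)
    case 0
    then show ?thesis using c by (simp add: Ck_on_0_iff[OF U])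
  next
    case (Suc l)
    have "partial i (\<lambda>q. q r) = (\<lambda>_. if r = i then 1 else 0)" for i
      unfolding partial_def by (rule ext) (rule vector_derivative_at[OF has_vector_derivative_coord])
    moreover have "(\<lambda>t. (p(i := t)) r) differentiable at (p i)" for p :: "nat \<Rightarrow> real" and i
      using has_vector_derivative_coord by (rule differentiableI_vector)
    ultimately show ?thesis unfolding Suc Ck_on_Suc_iff[OF U] using c by (simp add: Ck_on_const[OF U])
  qed
qed

lemma Ck_on_add:
  assumes U: "openin (Euclidean_space N) U" and "Ck_on k N U f" "Ck_on k N U g"
  shows "Ck_on k N U (\<lambda>q. f q + g q)"
  using assms(2,3)
proof (induction k arbitrary: f g)
  case 0
  then show ?case unfolding Ck_on_0_iff[OF U] by (intro continuous_intros)
next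
  case (Suc k)
  have der: "((\<lambda>t. f (p(i := t)) + g (p(i := t))) has_vector_derivative partial i f p + partial i g p) (at (p i))"
    if "i < N" "p \<in> U" for i p
    using has_partial_at[OF U Suc.prems(1) that] has_partial_at[OF U Suc.prems(2) that]
    by (rule has_vector_derivative_add)
  have "Ck_on k N U (partial i (\<lambda>q. f q + g q))" if i: "i < N" for i
  proof (rule Ck_on_cong[OF U])
    show "Ck_on k N U (\<lambda>q. partial i f q + partial i g q)" 
      using Suc i by (intro Suc.IH Ck_on_partial)
    show "partial i f q + partial i g q = partial i (\<lambda>q. f q + g q) q" if "q \<in> U" for q
      using vector_derivative_at[OF der[OF i that]] by (simp add: partial_def)
  qed
  moreover have "continuous_on U (\<lambda>q. f q + g q)"
    using Suc.prems[THEN Ck_on_continuous[OF U]] by (intro continuous_intros)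
  ultimately show ?case unfolding Ck_on_Suc_iff[OF U]
    using der differentiableI_vector by blast
qed

lemma Ck_on_scaleR:
  assumes U: "openin (Euclidean_space N) U" and "Ck_on k N U f" "Ck_on k N U g"
  shows "Ck_on k N U (\<lambda>q. f q *\<^sub>R g q)"
  using assms(2,3)
proof (induction k arbitrary: f g)
  case 0
  then show ?case unfolding Ck_on_0_iff[OF U] by (intro continuous_intros)
next
  case (Suc k)
  have der: "((\<lambda>t. f (p(i := t)) *\<^sub>R g (p(i := t))) has_vector_derivative
        f p *\<^sub>R partial i g p + partial i f p *\<^sub>R g p) (at (p i))"
    if "i < N" "p \<in> U" for i p
  proof -
    have "((\<lambda>t. f (p(i := t))) has_field_derivative partial i f p) (at (p i))"
      unfolding has_real_derivative_iff_has_vector_derivative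
      by (rule has_partial_at[OF U Suc.prems(1) that])
    from has_vector_derivative_scaleR[OF this, of "\<lambda>t. g (p(i := t))" "partial i g p"]
    show ?thesis using has_partial_at[OF U Suc.prems(2) that] by simp
  qed
  have "Ck_on k N U (partial i (\<lambda>q. f q *\<^sub>R g q))" if i: "i < N" for i
  proof (rule Ck_on_cong[OF U])
    have "Ck_on k N U f" "Ck_on k N U g" using Suc.prems Ck_on_SucD by blast+
    then show "Ck_on k N U (\<lambda>q. f q *\<^sub>R partial i g q + partial i f q *\<^sub>R g q)" 
      using Suc.prems i by (intro Ck_on_add[OF U] Suc.IH Ck_on_partial)
    show "f q *\<^sub>R partial i g q + partial i f q *\<^sub>R g q = partial i (\<lambda>q. f q *\<^sub>R g q) q" if "q \<in> U" for q
      using vector_derivative_at[OF der[OF i that]] by (simp add: partial_def)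
  qed
  moreover have "continuous_on U (\<lambda>q. f q *\<^sub>R g q)"
    using Suc.prems[THEN Ck_on_continuous[OF U]] by (intro continuous_intros)
  ultimately show ?case unfolding Ck_on_Suc_iff[OF U]
    using der differentiableI_vector by blast
qed

lemma Ck_on_sum:
  assumes U: "openin (Euclidean_space N) U" and "\<And>j. j \<in> J \<Longrightarrow> Ck_on k N U (f j)"
  shows "Ck_on k N U (\<lambda>q. \<Sum>j\<in>J. f j q)"
  using assms(2)
  by (induction J rule: infinite_finite_induct) (auto intro: Ck_on_add[OF U] Ck_on_const[OF U])

lemma continuous_on_into_Euclidean:
  fixes G :: "'a::topological_space \<Rightarrow> nat \<Rightarrow> real"
  assumes "\<And>q. q \<in> U \<Longrightarrow> G q \<in> topspace (Euclidean_space M)"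
    and "\<And>j. j < M \<Longrightarrow> continuous_on U (\<lambda>q. G q j)"
  shows "continuous_on U G"
proof (rule continuous_on_coordinatewise_then_product)
  fix j
  show "continuous_on U (\<lambda>q. G q j)"
  proof (cases "j < M")
    case False
    then have "continuous_on U (\<lambda>q. G q j) \<longleftrightarrow> continuous_on U (\<lambda>_. 0::real)"
      using assms(1) by (intro continuous_on_cong) (auto simp: topspace_Euclidean_space)
    then show ?thesis by simp
  qed (use assms in auto)
qed

lemma Ck_on_compose:
  assumes U: "openin (Euclidean_space N) U" and V: "openin (Euclidean_space M) V"
    and GV: "\<And>q. q \<in> U \<Longrightarrow> G q \<in> V"
    and "\<And>j. j < M \<Longrightarrow> Ck_on k N U (\<lambda>q. G q j)" and "Ck_on k M V h"
  shows "Ck_on k N U (\<lambda>q. h (G q))"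
  using assms(4,5)
proof (induction k arbitrary: h)
  case 0
  have "continuous_on U G"
    by (rule continuous_on_into_Euclidean[of _ _ M])
       (use GV openin_subset[OF V] 0 Ck_on_0_iff[OF U] in auto)
  then show ?case using 0(2) GV unfolding Ck_on_0_iff[OF U] Ck_on_0_iff[OF V]
    by (intro continuous_on_compose2[of V h U G]) auto
next
  case (Suc k)
  have "continuous_on U G"
    by (rule continuous_on_into_Euclidean[of _ _ M])
       (use GV openin_subset[OF V] in \<open>auto intro: Ck_on_continuous[OF U Suc.prems(1)]\<close>)
  then have cont: "continuous_on U (\<lambda>q. h (G q))"
    using Ck_on_continuous[OF V Suc.prems(2)] GV
    by (intro continuous_on_compose2[of V h U G]) auto
  have der: "((\<lambda>t. h (G (p(i := t)))) has_vector_derivative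
      (\<Sum>j<M. partial i (\<lambda>q. G q j) p *\<^sub>R partial j h (G p))) (at (p i))" if i: "i < N" and p: "p \<in> U" for i p
  proof -
    have "((\<lambda>t. h (G (p(i := t)))) has_vector_derivative
      (\<Sum>j<M. partial i (\<lambda>q. G q j) p *\<^sub>R partial j h (G (p(i := p i))))) (at (p i))"
    proof (rule chain_rule_curve[OF V Suc.prems(2)])
      show "G (p(i := p i)) \<in> V" using GV p by simp
      show "\<forall>\<^sub>F s in nhds (p i). G (p(i := s)) \<in> topspace (Euclidean_space M)"
        by (rule eventually_mono[OF eventually_update_in_open[OF U p i]])
           (use GV openin_subset[OF V] in auto)
      show "((\<lambda>s. G (p(i := s)) j) has_vector_derivative partial i (\<lambda>q. G q j) p) (at (p i))" if "j < M" for j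
        using has_partial_at[OF U Suc.prems(1)[OF that] i p] .
    qed
    then show ?thesis by simp
  qed
  have "Ck_on k N U (partial i (\<lambda>q. h (G q)))" if i: "i < N" for i
  proof (rule Ck_on_cong[OF U])
    show "Ck_on k N U (\<lambda>q. \<Sum>j<M. partial i (\<lambda>q. G q j) q *\<^sub>R partial j h (G q))"
    proof (intro Ck_on_sum[OF U] Ck_on_scaleR[OF U] Suc.IH)
      fix j assume "j \<in> {..<M}"
      then show "Ck_on k N U (partial i (\<lambda>q. G q j))" "Ck_on k M V (partial j h)"
        using Suc.prems i by (auto intro: Ck_on_partial)
    qed (use Suc.prems Ck_on_SucD in blast)
    show "(\<Sum>j<M. partial i (\<lambda>q. G q j) q *\<^sub>R partial j h (G q)) = partial i (\<lambda>q. h (G q)) q" if "q \<in> U" for q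
      using vector_derivative_at[OF der[OF i that]] by (simp add: partial_def)
  qed
  then show ?case unfolding Ck_on_Suc_iff[OF U]
    using cont der differentiableI_vector by blast
qed

section \<open>Symmetry of mixed partial derivatives\<close>

text \<open>
  For small \<open>h\<close>, the second difference of \<open>f\<close> over a square with side \<open>h\<close> is \<open>h * h\<close> times the mixed derivative, up
  to \<open>e * (h * h)\<close>. As the second difference is symmetric in \<open>i\<close> and \<open>j\<close>, so is the mixed derivative.
\<close>

lemma second_difference_bound:
  fixes f :: "(nat \<Rightarrow> real) \<Rightarrow> 'b::real_normed_vector"
  assumes U: "openin (Euclidean_space N) U" and f: "Ck_on (Suc (Suc k)) N U f" and p: "p \<in> U"
    and ij: "i < N" "j < N" "i \<noteq> j" and e: "e > 0"
  shows "\<exists>d>0. \<forall>h. 0 < h \<and> h < d \<longrightarrow>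
    norm (f (p(i := p i + h, j := p j + h)) - f (p(i := p i + h)) - f (p(j := p j + h)) + f p
        - (h * h) *\<^sub>R partial j (partial i f) p) \<le> e * (h * h)"
proof -
  let ?D = "partial j (partial i f) p"
  define W where "W = {q \<in> U. norm (partial j (partial i f) q - ?D) < e}"
  have fi: "Ck_on (Suc k) N U (partial i f)" using Ck_on_partial[OF f ij(1)] .
  have "openin (Euclidean_space N) W" unfolding W_def
    using openin_norm_diff_less[OF U Ck_on_continuous[OF U Ck_on_partial[OF fi ij(2)]]] .
  moreover have "p \<in> W" using p e by (simp add: W_def)
  ultimately obtain d where d: "d > 0"
    "\<And>q. q \<in> topspace (Euclidean_space N) \<Longrightarrow> (\<And>j. j < N \<Longrightarrow> \<bar>q j - p j\<bar> < d) \<Longrightarrow> q \<in> W"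
    using openin_Euclidean_box by metis
  have pE: "p \<in> topspace (Euclidean_space N)" using p openin_subset[OF U] by blast
  have "norm (f (p(i := p i + h, j := p j + h)) - f (p(i := p i + h)) - f (p(j := p j + h)) + f p
        - (h * h) *\<^sub>R ?D) \<le> e * (h * h)" if h: "0 < h" "h < d" for h
  proof -
    let ?I = "closed_segment (p i) (p i + h)" and ?J = "closed_segment (p j) (p j + h)"
    have inW: "p(i := s, j := t) \<in> W" if "s \<in> ?I" "t \<in> ?J" for s t
    proof (rule d(2))
      show "p(i := s, j := t) \<in> topspace (Euclidean_space N)"
        by (intro fun_upd_in_Euclidean pE ij)
      have "\<bar>s - p i\<bar> < d" "\<bar>t - p j\<bar> < d"
        using that h by (auto simp: closed_segment_eq_real_ivl)
      then show "\<bar>(p(i := s, j := t)) l - p l\<bar> < d" for l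
        using d(1) by auto
    qed
    then have inU: "p(i := s, j := t) \<in> U" if "s \<in> ?I" "t \<in> ?J" for s t
      using that by (auto simp: W_def)
    \<comment> \<open>mean value estimate in the direction \<open>j\<close> for \<open>partial i f\<close>, then in the direction \<open>i\<close> for \<open>f\<close>\<close>
    have inner: "norm (partial i f (p(i := s, j := p j + h)) - partial i f (p(i := s, j := p j)) - h *\<^sub>R ?D) \<le> e * h"
      if s: "s \<in> ?I" for s
    proof -
      have "norm ((\<lambda>t. partial i f (p(i := s, j := t)) - t *\<^sub>R ?D) (p j + h)
          - (\<lambda>t. partial i f (p(i := s, j := t)) - t *\<^sub>R ?D) (p j)) \<le> e * \<bar>p j + h - p j\<bar>"
      proof (rule vector_derivative_bound)
        fix t assume t: "t \<in> ?J"
        have "((\<lambda>t. partial i f (p(i := s, j := t)) - t *\<^sub>R ?D) has_vector_derivative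
            partial j (partial i f) (p(i := s, j := t)) - (t *\<^sub>R 0 + 1 *\<^sub>R ?D)) (at t within ?J)"
          using has_partial[OF U fi ij(2) inU[OF s t], of ?J]
          by (intro derivative_intros) auto
        then show "((\<lambda>t. partial i f (p(i := s, j := t)) - t *\<^sub>R ?D) has_vector_derivative
            partial j (partial i f) (p(i := s, j := t)) - ?D) (at t within ?J)" by simp
        show "norm (partial j (partial i f) (p(i := s, j := t)) - ?D) \<le> e"
          using inW[OF s t] by (auto simp: W_def less_imp_le)
      qed
      moreover have "(\<lambda>t. partial i f (p(i := s, j := t)) - t *\<^sub>R ?D) (p j + h)
          - (\<lambda>t. partial i f (p(i := s, j := t)) - t *\<^sub>R ?D) (p j)
        = partial i f (p(i := s, j := p j + h)) - partial i f (p(i := s, j := p j)) - h *\<^sub>R ?D"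
        by (simp only: scaleR_add_left) (simp only: algebra_simps)
      ultimately show ?thesis using h by simp
    qed
    have twist: "p(i := s, j := t) = p(j := t, i := s)" for s t
      using ij(3) by (rule fun_upd_twist)
    have A: "norm ((\<lambda>s. f (p(i := s, j := p j + h)) - f (p(i := s, j := p j)) - (s * h) *\<^sub>R ?D) (p i + h)
          - (\<lambda>s. f (p(i := s, j := p j + h)) - f (p(i := s, j := p j)) - (s * h) *\<^sub>R ?D) (p i))
        \<le> (e * h) * \<bar>p i + h - p i\<bar>"
    proof (rule vector_derivative_bound)
      fix s assume s: "s \<in> ?I"
      have D: "((\<lambda>s. f (p(i := s, j := t))) has_vector_derivative partial i f (p(i := s, j := t))) (at s within ?I)"
        if "t \<in> ?J" for t
        unfolding twist by (rule has_partial[OF U f ij(1)]) (use inU[OF s that] in \<open>simp only: twist\<close>)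
      have "((\<lambda>s. (s * h) *\<^sub>R ?D) has_vector_derivative (s * h) *\<^sub>R 0 + h *\<^sub>R ?D) (at s within ?I)"
        by (rule has_vector_derivative_scaleR) (auto intro!: derivative_eq_intros)
      then have "((\<lambda>s. f (p(i := s, j := p j + h)) - f (p(i := s, j := p j)) - (s * h) *\<^sub>R ?D) has_vector_derivative
          partial i f (p(i := s, j := p j + h)) - partial i f (p(i := s, j := p j)) - ((s * h) *\<^sub>R 0 + h *\<^sub>R ?D))
          (at s within ?I)"
        by (intro has_vector_derivative_diff D) auto
      then show "((\<lambda>s. f (p(i := s, j := p j + h)) - f (p(i := s, j := p j)) - (s * h) *\<^sub>R ?D) has_vector_derivative
          partial i f (p(i := s, j := p j + h)) - partial i f (p(i := s, j := p j)) - h *\<^sub>R ?D)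
          (at s within ?I)" by simp
      show "norm (partial i f (p(i := s, j := p j + h)) - partial i f (p(i := s, j := p j)) - h *\<^sub>R ?D) \<le> e * h"
        using inner[OF s] .
    qed
    have E: "(\<lambda>s. f (p(i := s, j := p j + h)) - f (p(i := s, j := p j)) - (s * h) *\<^sub>R ?D) (p i + h)
          - (\<lambda>s. f (p(i := s, j := p j + h)) - f (p(i := s, j := p j)) - (s * h) *\<^sub>R ?D) (p i)
       = f (p(i := p i + h, j := p j + h)) - f (p(i := p i + h)) - f (p(j := p j + h)) + f p - (h * h) *\<^sub>R ?D"
    proof -
      have "p(i := p i + h, j := p j) = p(i := p i + h)" using ij(3) by auto
      moreover have "((p i + h) * h) *\<^sub>R ?D = (p i * h) *\<^sub>R ?D + (h * h) *\<^sub>R ?D"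
        by (simp add: algebra_simps)
      ultimately show ?thesis by (simp only: fun_upd_triv) (simp only: algebra_simps)
    qed
    have "norm (f (p(i := p i + h, j := p j + h)) - f (p(i := p i + h)) - f (p(j := p j + h)) + f p
        - (h * h) *\<^sub>R ?D) \<le> (e * h) * \<bar>p i + h - p i\<bar>"
      using A by (simp only: E)
    then show ?thesis using h by (simp add: mult.assoc)
  qed
  then show ?thesis using d(1) by blast
qed

lemma partial_commute:
  fixes f :: "(nat \<Rightarrow> real) \<Rightarrow> 'b::real_normed_vector"
  assumes U: "openin (Euclidean_space N) U" and f: "Ck_on (Suc (Suc k)) N U f" and p: "p \<in> U"
    and ij: "i < N" "j < N"
  shows "partial i (partial j f) p = partial j (partial i f) p"
proof (cases "i = j")
  case ne: False
  let ?A = "partial j (partial i f) p" and ?B = "partial i (partial j f) p"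
  have bound: "norm (?B - ?A) \<le> 2 * e" if e: "e > 0" for e
  proof -
    let ?\<Delta> = "\<lambda>h. f (p(i := p i + h, j := p j + h)) - f (p(i := p i + h)) - f (p(j := p j + h)) + f p"
    obtain d1 where d1: "d1 > 0" "\<And>h. 0 < h \<Longrightarrow> h < d1 \<Longrightarrow> norm (?\<Delta> h - (h * h) *\<^sub>R ?A) \<le> e * (h * h)"
      using second_difference_bound[OF U f p ij ne e] by blast
    obtain d2 where d2: "d2 > 0" "\<And>h. 0 < h \<Longrightarrow> h < d2 \<Longrightarrow>
        norm (f (p(j := p j + h, i := p i + h)) - f (p(j := p j + h)) - f (p(i := p i + h)) + f p
           - (h * h) *\<^sub>R ?B) \<le> e * (h * h)"
      using second_difference_bound[OF U f p ij(2,1) ne[symmetric] e] by blast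
    define h where "h = min d1 d2 / 2"
    have h: "0 < h" "h < d1" "h < d2" using d1(1) d2(1) by (auto simp: h_def)
    have E: "f (p(j := p j + h, i := p i + h)) - f (p(j := p j + h)) - f (p(i := p i + h)) + f p = ?\<Delta> h"
      unfolding fun_upd_twist[OF ne] by (simp only: algebra_simps)
    have 2: "norm (?\<Delta> h - (h * h) *\<^sub>R ?B) \<le> e * (h * h)" using d2(2)[OF h(1,3)] by (simp only: E)
    have "(h * h) *\<^sub>R (?B - ?A) = (?\<Delta> h - (h * h) *\<^sub>R ?A) - (?\<Delta> h - (h * h) *\<^sub>R ?B)"
      by (simp only: algebra_simps)
    then have "norm ((h * h) *\<^sub>R (?B - ?A)) \<le> e * (h * h) + e * (h * h)"
      using norm_triangle_le_diff[OF add_mono[OF d1(2)[OF h(1,2)] 2]] by simp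
    then have "(h * h) * norm (?B - ?A) \<le> (h * h) * (2 * e)" using h by simp
    then show ?thesis using h by (simp add: mult_le_cancel_left_pos)
  qed
  show ?thesis
  proof (rule ccontr)
    assume "?B \<noteq> ?A"
    then have "norm (?B - ?A) > 0" by simp
    with bound[of "norm (?B - ?A) / 4"] show False by linarith
  qed
qed simp

text \<open>
  Iterated partial derivatives are written \<open>foldr partial rs f\<close>, where the last index in \<open>rs\<close> is
  differentiated first.
\<close>

lemma Ck_on_foldr_partial:
  assumes "set rs \<subseteq> {..<N}" and "Ck_on (length rs + k) N U f"
  shows "Ck_on k N U (foldr partial rs f)"
  using assms
proof (induction rs arbitrary: k)
  case (Cons r rs)
  from Cons.IH[of "Suc k"] Cons.prems have "Ck_on (Suc k) N U (foldr partial rs f)" by simp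
  then show ?case using Cons.prems(1) by (auto intro: Ck_on_partial)
qed simp

lemma foldr_partial_cong:
  assumes "openin (Euclidean_space N) U" and "\<And>q. q \<in> U \<Longrightarrow> f q = g q"
    and "set rs \<subseteq> {..<N}" and "p \<in> U"
  shows "foldr partial rs f p = foldr partial rs g p"
  using assms(3,4)
proof (induction rs arbitrary: p)
  case (Cons r rs)
  then show ?case
    using partial_cong[OF assms(1), of p r "foldr partial rs f" "foldr partial rs g"] by auto
qed (use assms(2) in auto)

lemma foldr_partial_move:
  assumes U: "openin (Euclidean_space N) U" and f: "\<And>k. Ck_on k N U f"
    and "set (xs @ r # ys) \<subseteq> {..<N}" and "p \<in> U"
  shows "foldr partial (xs @ r # ys) f p = partial r (foldr partial (xs @ ys) f) p"
  using assms(3,4)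
proof (induction xs arbitrary: p)
  case (Cons a xs)
  have "partial a (foldr partial (xs @ r # ys) f) p = partial a (partial r (foldr partial (xs @ ys) f)) p"
    by (rule partial_cong[OF U Cons.prems(2)]) (use Cons in auto)
  also have "\<dots> = partial r (partial a (foldr partial (xs @ ys) f)) p"
    by (rule partial_commute[OF U Ck_on_foldr_partial[OF _ f] Cons.prems(2)]) (use Cons.prems in auto)
  finally show ?case by simp
qed simp

text \<open>
  For smooth functions the order of differentiation does not matter.
\<close>

lemma foldr_partial_mset_eq:
  assumes U: "openin (Euclidean_space N) U" and f: "\<And>k. Ck_on k N U f"
    and "mset xs = mset ys" and "set xs \<subseteq> {..<N}" and "p \<in> U"
  shows "foldr partial xs f p = foldr partial ys f p"
  using assms(3-5)
proof (induction xs arbitrary: ys p)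
  case (Cons a xs)
  from Cons.prems(1) have "a \<in> set ys" by (metis list.set_intros(1) set_mset_mset)
  then obtain us vs where ys: "ys = us @ a # vs" by (meson split_list)
  with Cons.prems(1) have m: "mset xs = mset (us @ vs)" by simp
  have "set ys \<subseteq> {..<N}" using Cons.prems(1,2) by (metis set_mset_mset)
  then have "foldr partial ys f p = partial a (foldr partial (us @ vs) f) p"
    unfolding ys using foldr_partial_move[OF U f _ Cons.prems(3)] by simp
  also have "\<dots> = partial a (foldr partial xs f) p"
    by (rule partial_cong[OF U Cons.prems(3)]) (use Cons.IH[OF m] Cons.prems in auto)
  finally show ?case by simp
qed simp

lemma multi_partial_eq_foldr:
  "multi_partial N \<alpha> f = foldr partial (concat (map (\<lambda>r. replicate (\<alpha> r) r) [0..<N])) f"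
proof -
  have **: "foldr partial (replicate n r) g = (partial r ^^ n) g"
    for n r and g :: "(nat \<Rightarrow> real) \<Rightarrow> 'a"
    by (induction n) auto
  have "foldr (\<lambda>r. partial r ^^ \<alpha> r) rs f = foldr partial (concat (map (\<lambda>r. replicate (\<alpha> r) r) rs)) f" for rs
    by (induction rs) (auto simp: **)
  then show ?thesis by (simp add: multi_partial_def)
qed

section \<open>Antisymmetric coefficients and determinants\<close>

lemma strict_mono_on_eq_sorted_list:
  fixes s :: "nat \<Rightarrow> nat"
  assumes "strict_mono_on {..<n} s"
  shows "map s [0..<n] = sorted_list_of_set (s ` {..<n})"
proof -
  have inj: "inj_on s {..<n}" using assms by (rule strict_mono_on_imp_inj_on)
  have "sorted_wrt (<) (map s [0..<n])"
    using assms by (auto simp: sorted_wrt_map sorted_wrt_iff_nth_less strict_mono_on_def)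
  then have "sorted (map s [0..<n])" "distinct (map s [0..<n])"
    by (auto simp: strict_sorted_iff)
  moreover have "set (map s [0..<n]) = s ` {..<n}" by auto
  ultimately show ?thesis
    by (metis sorted_list_of_set.idem_if_sorted_distinct)
qed

text \<open>
  Every injective map factors uniquely as a permutation followed by an increasing map.
\<close>

lemma bij_betw_strict_mono_permutation:
  "bij_betw (\<lambda>(s, \<sigma>). \<lambda>j\<in>{..<n}. s (\<sigma> j))
     ({s \<in> {..<n} \<rightarrow>\<^sub>E {..<m::nat}. strict_mono_on {..<n::nat} s} \<times> {\<sigma>. \<sigma> permutes {..<n}})
     {i \<in> {..<n} \<rightarrow>\<^sub>E {..<m}. inj_on i {..<n}}"
  (is "bij_betw ?h (?S \<times> ?P) ?I")
proof (rule bij_betwI')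
  fix x y assume xy: "x \<in> ?S \<times> ?P" "y \<in> ?S \<times> ?P"
  obtain s \<sigma> s' \<sigma>' where eq: "x = (s, \<sigma>)" "y = (s', \<sigma>')" by (meson surj_pair)
  have s: "s \<in> {..<n} \<rightarrow>\<^sub>E {..<m}" "strict_mono_on {..<n} s" "\<sigma> permutes {..<n}"
    and s': "s' \<in> {..<n} \<rightarrow>\<^sub>E {..<m}" "strict_mono_on {..<n} s'" "\<sigma>' permutes {..<n}"
    using xy eq by auto
  show "?h x = ?h y \<longleftrightarrow> x = y"
  proof
    assume "?h x = ?h y"
    then have *: "s (\<sigma> j) = s' (\<sigma>' j)" if "j < n" for j
      using that unfolding eq by (metis (no_types, lifting) case_prod_conv lessThan_iff restrict_apply')
    have "s ` {..<n} = (\<lambda>j. s (\<sigma> j)) ` {..<n}"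
      using permutes_image[OF s(3)] by (metis image_image)
    also have "\<dots> = (\<lambda>j. s' (\<sigma>' j)) ` {..<n}" using * by (intro image_cong) auto
    also have "\<dots> = s' ` {..<n}" using permutes_image[OF s'(3)] by (metis image_image)
    finally have "map s [0..<n] = map s' [0..<n]"
      using strict_mono_on_eq_sorted_list s(2) s'(2) by metis
    then have ss: "s = s'" using s(1) s'(1) by (intro PiE_ext[OF s(1) s'(1)]) auto
    have "\<sigma> j = \<sigma>' j" for j
    proof (cases "j < n")
      case True
      have "inj_on s {..<n}" using s(2) by (rule strict_mono_on_imp_inj_on)
      then show ?thesis using *[OF True] True ss
          permutes_in_image[OF s(3), of j] permutes_in_image[OF s'(3), of j]
        by (auto dest: inj_onD)
    qed (use permutes_not_in[OF s(3)] permutes_not_in[OF s'(3)] in auto)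
    then show "x = y" using eq ss by auto
  qed auto
next
  fix x assume "x \<in> ?S \<times> ?P"
  then obtain s \<sigma> where x: "x = (s, \<sigma>)" "s \<in> {..<n} \<rightarrow>\<^sub>E {..<m}" "strict_mono_on {..<n} s" "\<sigma> permutes {..<n}"
    by auto
  have inj: "inj_on s {..<n}" using x(3) by (rule strict_mono_on_imp_inj_on)
  have "inj_on (s \<circ> \<sigma>) {..<n}"
    by (rule comp_inj_on) (use inj permutes_inj_on[OF x(4)] permutes_image[OF x(4)] in auto)
  then have "inj_on (?h x) {..<n}" unfolding x(1) by (simp add: inj_on_def)
  moreover have "?h x \<in> {..<n} \<rightarrow>\<^sub>E {..<m}"
    unfolding x(1) using x(2) permutes_in_image[OF x(4)] by (auto simp: PiE_iff)
  ultimately show "?h x \<in> ?I" by simp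
next
  fix i assume "i \<in> ?I"
  then have i: "i \<in> {..<n} \<rightarrow>\<^sub>E {..<m}" "inj_on i {..<n}" by auto
  \<comment> \<open>the increasing map enumerates the image of \<open>i\<close>\<close>
  define A where "A = i ` {..<n}"
  define L where "L = sorted_list_of_set A"
  have A: "finite A" "card A = n" unfolding A_def using card_image[OF i(2)] by auto
  have L: "length L = n" "set L = A" "sorted_wrt (<) L" "distinct L"
    unfolding L_def using A by auto
  define s where "s = (\<lambda>j\<in>{..<n}. L ! j)"
  have smono: "strict_mono_on {..<n} s"
    using L sorted_wrt_nth_less[OF L(3)] by (auto simp: s_def strict_mono_on_def)
  have sA: "s ` {..<n} = A"
    unfolding s_def using L(1,2) by (auto simp: set_conv_nth image_def)
  have sbij: "bij_betw s {..<n} A"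
    using strict_mono_on_imp_inj_on[OF smono] sA by (simp add: bij_betw_def)
  have ibij: "bij_betw i {..<n} A" using i(2) by (simp add: bij_betw_def A_def)
  define \<sigma> where "\<sigma> j = (if j < n then inv_into {..<n} s (i j) else j)" for j
  have "bij_betw (inv_into {..<n} s \<circ> i) {..<n} {..<n}"
    using ibij bij_betw_inv_into[OF sbij] by (rule bij_betw_trans)
  then have "bij_betw \<sigma> {..<n} {..<n}"
    by (rule bij_betw_cong[THEN iffD1, rotated]) (simp add: \<sigma>_def)
  then have \<sigma>: "\<sigma> permutes {..<n}" by (rule bij_imp_permutes) (simp add: \<sigma>_def)
  have "s (\<sigma> j) = i j" if "j < n" for j
    unfolding \<sigma>_def using that sA A_def by (auto intro!: f_inv_into_f)
  then have "i = ?h (s, \<sigma>)" using i(1) by (auto simp: fun_eq_iff PiE_def extensional_def)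
  moreover have "s \<in> {..<n} \<rightarrow>\<^sub>E {..<m}"
  proof -
    have "L ! j \<in> i ` {..<n}" if "j < n" for j
      using nth_mem[of j L] that L(1,2) by (simp add: A_def)
    then have "L ! j < m" if "j < n" for j using i(1) that by force
    then show ?thesis by (simp add: s_def restrict_PiE_iff)
  qed
  ultimately show "\<exists>x\<in>?S \<times> ?P. i = ?h x" using smono \<sigma> by blast
qed

lemma sum_antisymmetric_eq_sum_det:
  fixes c :: "(nat \<Rightarrow> nat) \<Rightarrow> complex" and w :: "nat \<Rightarrow> nat \<Rightarrow> real"
  assumes c: "\<And>i \<sigma>. i \<in> {..<n} \<rightarrow>\<^sub>E {..<m} \<Longrightarrow> \<sigma> permutes {..<n} \<Longrightarrow>
      c (\<lambda>j\<in>{..<n}. i (\<sigma> j)) = of_int (sign \<sigma>) * c i"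
  shows "(\<Sum>i \<in> {..<n} \<rightarrow>\<^sub>E {..<m}. c i * of_real (\<Prod>a<n. w a (i a))) =
    (\<Sum>i \<in> {i \<in> {..<n} \<rightarrow>\<^sub>E {..<m}. strict_mono_on {..<n} i}.
       c i * of_real (Determinant.det (Matrix.mat n n (\<lambda>(a, b). w a (i b)))))"
proof -
  let ?S = "{s \<in> {..<n} \<rightarrow>\<^sub>E {..<m}. strict_mono_on {..<n} s}"
  let ?P = "{\<sigma>. \<sigma> permutes {..<n}}"
  let ?I = "{i \<in> {..<n} \<rightarrow>\<^sub>E {..<m}. inj_on i {..<n}}"
  let ?g = "\<lambda>i. c i * of_real (\<Prod>a<n. w a (i a))"
  have zero: "c i = 0" if i: "i \<in> {..<n} \<rightarrow>\<^sub>E {..<m}" "\<not> inj_on i {..<n}" for i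
  proof -
    obtain a b where ab: "a < n" "b < n" "a \<noteq> b" "i a = i b"
      using i(2) by (auto simp: inj_on_def)
    have "(\<lambda>j\<in>{..<n}. i (Transposition.transpose a b j)) = i"
      using i(1) ab by (auto simp: fun_eq_iff Transposition.transpose_def PiE_def extensional_def)
    moreover have "Transposition.transpose a b permutes {..<n}"
      using ab by (auto intro: permutes_swap_id)
    ultimately have "c i = of_int (sign (Transposition.transpose a b)) * c i"
      using c[OF i(1)] by metis
    then have "c i = - c i" using ab(3) by (simp add: sign_swap_id)
    then show ?thesis by simp
  qed
  have det: "Determinant.det (Matrix.mat n n (\<lambda>(a, b). w a (i b)))
      = (\<Sum>\<sigma>\<in>?P. of_int (sign \<sigma>) * (\<Prod>a<n. w a (i (\<sigma> a))))" for i
  proof -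
    have "Determinant.det (Matrix.mat n n (\<lambda>(a, b). w a (i b))) =
      (\<Sum>\<sigma> | \<sigma> permutes {0..<n}. signof \<sigma> * (\<Prod>a=0..<n. Matrix.mat n n (\<lambda>(a, b). w a (i b)) $$ (a, \<sigma> a)))"
      by (simp add: Determinant.det_def)
    also have "\<dots> = (\<Sum>\<sigma>\<in>?P. of_int (sign \<sigma>) * (\<Prod>a<n. w a (i (\<sigma> a))))"
      unfolding lessThan_atLeast0[symmetric]
    proof (rule sum.cong[OF refl])
      fix \<sigma> assume "\<sigma> \<in> ?P"
      then have "\<sigma> a < n" if "a < n" for a using that permutes_in_image[of \<sigma> "{..<n}" a] by simp
      then have "(\<Prod>a<n. Matrix.mat n n (\<lambda>(a, b). w a (i b)) $$ (a, \<sigma> a)) = (\<Prod>a<n. w a (i (\<sigma> a)))"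
        by (intro prod.cong) auto
      then show "signof \<sigma> * (\<Prod>a<n. Matrix.mat n n (\<lambda>(a, b). w a (i b)) $$ (a, \<sigma> a))
          = of_int (sign \<sigma>) * (\<Prod>a<n. w a (i (\<sigma> a)))"
        by simp
    qed
    finally show ?thesis .
  qed
  have "(\<Sum>i \<in> {..<n} \<rightarrow>\<^sub>E {..<m}. ?g i) = (\<Sum>i\<in>?I. ?g i)"
    by (rule sum.mono_neutral_right) (use zero in \<open>auto intro: finite_PiE\<close>)
  also have "\<dots> = (\<Sum>x\<in>?S \<times> ?P. ?g ((\<lambda>(s, \<sigma>). \<lambda>j\<in>{..<n}. s (\<sigma> j)) x))"
    by (rule sum.reindex_bij_betw[OF bij_betw_strict_mono_permutation, symmetric])
  also have "\<dots> = (\<Sum>(s, \<sigma>)\<in>?S \<times> ?P. c s * of_real (of_int (sign \<sigma>) * (\<Prod>a<n. w a (s (\<sigma> a)))))"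
  proof (rule sum.cong[OF refl])
    fix x assume "x \<in> ?S \<times> ?P"
    then obtain s \<sigma> where x: "x = (s, \<sigma>)" "s \<in> {..<n} \<rightarrow>\<^sub>E {..<m}" "\<sigma> permutes {..<n}" by blast
    have "(\<Prod>a<n. w a ((\<lambda>j\<in>{..<n}. s (\<sigma> j)) a)) = (\<Prod>a<n. w a (s (\<sigma> a)))"
      by (rule prod.cong) simp_all
    then show "?g ((\<lambda>(s, \<sigma>). \<lambda>j\<in>{..<n}. s (\<sigma> j)) x)
        = (\<lambda>(s, \<sigma>). c s * of_real (of_int (sign \<sigma>) * (\<Prod>a<n. w a (s (\<sigma> a))))) x"
      unfolding x(1) by (simp add: c[OF x(2,3)] del: restrict_apply)
  qed
  also have "\<dots> = (\<Sum>s\<in>?S. \<Sum>\<sigma>\<in>?P. c s * of_real (of_int (sign \<sigma>) * (\<Prod>a<n. w a (s (\<sigma> a)))))"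
    by (rule sum.cartesian_product[symmetric])
  also have "\<dots> = (\<Sum>s\<in>?S. c s * of_real (Determinant.det (Matrix.mat n n (\<lambda>(a, b). w a (s b)))))"
    unfolding det by (simp add: sum_distrib_left)
  finally show ?thesis .
qed

section \<open>Multi-indices with one entry in each block\<close>

text \<open>The positions picked by \<open>i\<close>, one in each of \<open>n\<close> blocks of length \<open>m\<close>.\<close>

definition block_positions :: "nat \<Rightarrow> nat \<Rightarrow> (nat \<Rightarrow> nat) \<Rightarrow> nat set" where
  "block_positions n m i = (\<lambda>a. a * m + i a) ` {..<n}"

lemma block_index_less: "a < n \<Longrightarrow> l < m \<Longrightarrow> a * m + l < n * (m::nat)"
proof -
  assume "a < n" "l < m"
  then have "a * m + l < Suc a * m" by simp
  also have "\<dots> \<le> n * m" using \<open>a < n\<close> by (intro mult_le_mono1) simp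
  finally show ?thesis .
qed

lemma block_index_eq_iff:
  "l < m \<Longrightarrow> l' < m \<Longrightarrow> a * m + l = a' * m + l' \<longleftrightarrow> a = a' \<and> l = (l'::nat)"
proof
  assume *: "l < m" "l' < m" "a * m + l = a' * m + l'"
  have "(a * m + l) div m = a" using *(1) by simp
  moreover have "(a' * m + l') div m = a'" using *(2) by simp
  ultimately have "a = a'" using *(3) by metis
  with *(3) show "a = a' \<and> l = l'" by simp
qed simp

lemma inj_on_block_index:
  assumes "\<And>a. a < n \<Longrightarrow> i a < m"
  shows "inj_on (\<lambda>a. a * m + i a) {..<n::nat}"
  using assms by (auto simp: inj_on_def block_index_eq_iff)

text \<open>
  Pigeonhole: a multi-index of total degree at most \<open>n\<close> that is nonzero in each of \<open>n\<close> blocks is the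
  indicator of a set with exactly one position in each block.
\<close>

lemma multi_index_one_per_block:
  fixes \<alpha> :: "nat \<Rightarrow> nat"
  assumes supp: "\<And>r. r \<ge> n * m \<Longrightarrow> \<alpha> r = 0" and le: "(\<Sum>r<n * m. \<alpha> r) \<le> n"
    and ex: "\<And>a. a < n \<Longrightarrow> \<exists>l<m. \<alpha> (a * m + l) \<noteq> 0"
  shows "\<exists>i \<in> {..<n} \<rightarrow>\<^sub>E {..<m}. \<alpha> = indicator (block_positions n m i)"
proof -
  obtain i0 where i0: "\<And>a. a < n \<Longrightarrow> i0 a < m \<and> \<alpha> (a * m + i0 a) \<noteq> 0" using ex by metis
  define i where "i = restrict i0 {..<n}"
  have i: "i \<in> {..<n} \<rightarrow>\<^sub>E {..<m}" using i0 by (auto simp: i_def)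
  have im: "i a < m" if "a < n" for a using i0 that by (simp add: i_def)
  let ?R = "block_positions n m i"
  have R: "?R \<subseteq> {..<n * m}" using im by (auto simp: block_positions_def intro: block_index_less)
  have cR: "card ?R = n"
    unfolding block_positions_def by (subst card_image[OF inj_on_block_index]) (use im in auto)
  have ge: "indicator ?R r \<le> \<alpha> r" for r
    using i0 by (auto simp: block_positions_def indicator_def i_def Suc_le_eq)
  have "(\<Sum>r<n * m. indicator ?R r :: nat) = card ?R"
    using R by (simp add: sum_indicator_eq_card Int_absorb1)
  then have "(\<Sum>r<n * m. \<alpha> r) \<le> (\<Sum>r<n * m. indicator ?R r)" using cR le by simp
  then have eq: "(\<Sum>r<n * m. indicator ?R r) = (\<Sum>r<n * m. \<alpha> r)"
    by (rule antisym[rotated]) (rule sum_mono, rule ge)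
  have "indicator ?R r = \<alpha> r" for r
  proof (cases "r < n * m")
    case True
    then show ?thesis using sum_mono_inv[OF eq] ge by blast
  next
    case False
    then show ?thesis using supp[of r] R by (auto simp: indicator_def)
  qed
  then have "\<alpha> = indicator ?R" by auto
  then show ?thesis using i by blast
qed

lemma inj_on_indicator_block_positions:
  "inj_on (\<lambda>i. indicator (block_positions n m i) :: nat \<Rightarrow> nat) ({..<n} \<rightarrow>\<^sub>E {..<m})"
proof (rule inj_onI)
  fix i i' assume i: "i \<in> {..<n} \<rightarrow>\<^sub>E {..<m}" and i': "i' \<in> {..<n} \<rightarrow>\<^sub>E {..<m}"
    and eq: "indicator (block_positions n m i) = (indicator (block_positions n m i') :: nat \<Rightarrow> nat)"
  have R: "block_positions n m i = block_positions n m i'"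
    using eq by (metis indicator_eq_1_iff subsetI subset_antisym)
  show "i = i'"
  proof (rule PiE_ext[OF i i'])
    fix a assume a: "a \<in> {..<n}"
    then have "a * m + i a \<in> block_positions n m i'" using R by (auto simp: block_positions_def)
    then obtain a' where "a' < n" "a * m + i a = a' * m + i' a'" by (auto simp: block_positions_def)
    then show "i a = i' a" using a i i' block_index_eq_iff[of "i a" m "i' a'" a a'] by auto
  qed
qed

lemma multi_partial_indicator:
  assumes U: "openin (Euclidean_space (n * m)) U" and f: "\<And>k. Ck_on k (n * m) U f" and p: "p \<in> U"
    and i: "\<And>a. a < n \<Longrightarrow> i a < m"
  shows "multi_partial (n * m) (indicator (block_positions n m i)) f p
    = foldr partial (map (\<lambda>a. a * m + i a) [0..<n]) f p"
proof -
  let ?R = "block_positions n m i"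
  let ?xs = "concat (map (\<lambda>r. replicate (indicator ?R r) r) [0..<n * m])"
  have R: "?R \<subseteq> {..<n * m}" using i by (auto simp: block_positions_def intro: block_index_less)
  have xs: "?xs = filter (\<lambda>r. r \<in> ?R) [0..<n * m]"
  proof -
    have "concat (map (\<lambda>r. replicate (indicator ?R r) r) rs) = filter (\<lambda>r. r \<in> ?R) rs" for rs
      by (induction rs) (auto simp: indicator_def)
    then show ?thesis .
  qed
  have "distinct ?xs" "set ?xs = ?R" unfolding xs using R by auto
  moreover have "distinct (map (\<lambda>a. a * m + i a) [0..<n])"
    "set (map (\<lambda>a. a * m + i a) [0..<n]) = ?R"
    using inj_on_block_index[of n i m] i by (auto simp: distinct_map block_positions_def lessThan_atLeast0)
  ultimately have "mset ?xs = mset (map (\<lambda>a. a * m + i a) [0..<n])"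
    by (metis set_eq_iff_mset_eq_distinct)
  then show ?thesis unfolding multi_partial_eq_foldr
    using R \<open>set ?xs = ?R\<close> by (intro foldr_partial_mset_eq[OF U f _ _ p]) auto
qed

text \<open>
  If all derivatives that omit some block vanish at \<open>p\<close>, the Taylor polynomial of total degree \<open>n\<close> at
  \<open>p\<close> contains only the monomials that are linear in each of the \<open>n\<close> blocks.
\<close>

lemma taylor_poly_one_per_block:
  assumes U: "openin (Euclidean_space (n * m)) U" and f: "\<And>k. Ck_on k (n * m) U f" and p: "p \<in> U"
    and vanish: "\<And>\<alpha> a. a < n \<Longrightarrow> \<forall>l<m. \<alpha> (a * m + l) = 0 \<Longrightarrow> multi_partial (n * m) \<alpha> f p = 0"
  shows "taylor_poly (n * m) n f p z = (\<Sum>i \<in> {..<n} \<rightarrow>\<^sub>E {..<m}.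
     foldr partial (map (\<lambda>a. a * m + i a) [0..<n]) f p *
     of_real (\<Prod>a<n. z (a * m + i a) - p (a * m + i a)))"
proof -
  let ?N = "n * m"
  let ?A = "{\<alpha>. (\<forall>r\<ge>?N. \<alpha> r = 0) \<and> (\<Sum>r<?N. \<alpha> r) \<le> n}"
  let ?I = "{..<n} \<rightarrow>\<^sub>E {..<m}"
  let ?\<delta> = "\<lambda>i. indicator (block_positions n m i) :: nat \<Rightarrow> nat"
  define T where "T \<alpha> = multi_partial ?N \<alpha> f p / of_nat (\<Prod>r<?N. fact (\<alpha> r)) *
        of_real (\<Prod>r<?N. (z r - p r) ^ \<alpha> r)" for \<alpha>
  have "?A \<subseteq> {\<alpha>. \<forall>r. (r \<in> {..<?N} \<longrightarrow> \<alpha> r \<in> {..n}) \<and> (r \<notin> {..<?N} \<longrightarrow> \<alpha> r = 0)}"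
  proof
    fix \<alpha> assume "\<alpha> \<in> ?A"
    then have \<alpha>: "\<forall>r\<ge>?N. \<alpha> r = 0" "(\<Sum>r<?N. \<alpha> r) \<le> n" by simp_all
    have "\<alpha> r \<le> n" if "r < ?N" for r
      using member_le_sum[of r "{..<?N}" \<alpha>] that \<alpha>(2) by simp
    then show "\<alpha> \<in> {\<alpha>. \<forall>r. (r \<in> {..<?N} \<longrightarrow> \<alpha> r \<in> {..n}) \<and> (r \<notin> {..<?N} \<longrightarrow> \<alpha> r = 0)}"
      using \<alpha>(1) by (simp add: not_less)
  qed
  moreover have "finite {\<alpha>. \<forall>r. (r \<in> {..<?N} \<longrightarrow> \<alpha> r \<in> {..n}) \<and> (r \<notin> {..<?N} \<longrightarrow> \<alpha> r = 0)}"
    by (rule finite_set_of_finite_funs) auto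
  ultimately have finA: "finite ?A" by (rule finite_subset)
  have RN: "block_positions n m i \<subseteq> {..<?N}" and cR: "card (block_positions n m i) = n" if "i \<in> ?I" for i
  proof -
    have i: "i a < m" if "a < n" for a using \<open>i \<in> ?I\<close> that by auto
    show "block_positions n m i \<subseteq> {..<?N}"
      using i by (auto simp: block_positions_def intro: block_index_less)
    show "card (block_positions n m i) = n"
      unfolding block_positions_def by (subst card_image[OF inj_on_block_index]) (use i in auto)
  qed
  have \<delta>A: "?\<delta> ` ?I \<subseteq> ?A"
  proof
    fix \<alpha> assume "\<alpha> \<in> ?\<delta> ` ?I"
    then obtain i where i: "i \<in> ?I" "\<alpha> = ?\<delta> i" by blast
    have "(\<Sum>r<?N. \<alpha> r) = n"
      using RN[OF i(1)] cR[OF i(1)] by (simp add: i(2) sum_indicator_eq_card Int_absorb1)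
    moreover have "\<alpha> r = 0" if "r \<ge> ?N" for r
      using RN[OF i(1)] that by (auto simp: i(2) indicator_def)
    ultimately show "\<alpha> \<in> ?A" by simp
  qed
  have "taylor_poly ?N n f p z = (\<Sum>\<alpha>\<in>?A. T \<alpha>)" by (simp add: taylor_poly_def T_def)
  also have "\<dots> = (\<Sum>\<alpha>\<in>?\<delta> ` ?I. T \<alpha>)"
  proof (rule sum.mono_neutral_right[OF finA \<delta>A], rule ballI)
    fix \<alpha> assume \<alpha>: "\<alpha> \<in> ?A - ?\<delta> ` ?I"
    then obtain a where "a < n" "\<forall>l<m. \<alpha> (a * m + l) = 0"
      using multi_index_one_per_block[of n m \<alpha>] by blast
    then show "T \<alpha> = 0" using vanish by (simp add: T_def)
  qed
  also have "\<dots> = (\<Sum>i\<in>?I. T (?\<delta> i))"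
    by (simp add: sum.reindex[OF inj_on_indicator_block_positions])
  also have "\<dots> = (\<Sum>i\<in>?I. foldr partial (map (\<lambda>a. a * m + i a) [0..<n]) f p *
     of_real (\<Prod>a<n. z (a * m + i a) - p (a * m + i a)))"
  proof (rule sum.cong[OF refl])
    fix i assume i: "i \<in> ?I"
    then have im: "i a < m" if "a < n" for a using that by auto
    have "(\<Prod>r<?N. (z r - p r) ^ ?\<delta> i r) = (\<Prod>r\<in>block_positions n m i. z r - p r)"
      by (rule prod.mono_neutral_cong_right) (use RN[OF i] in \<open>auto simp: indicator_def\<close>)
    also have "\<dots> = (\<Prod>a<n. z (a * m + i a) - p (a * m + i a))"
      unfolding block_positions_def by (subst prod.reindex[OF inj_on_block_index]) (use im in auto)
    finally have 1: "(\<Prod>r<?N. (z r - p r) ^ ?\<delta> i r) = \<dots>" .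
    have "(\<Prod>r<?N. fact (?\<delta> i r) :: nat) = 1" by (rule prod.neutral) (auto simp: indicator_def)
    moreover have "multi_partial ?N (?\<delta> i) f p = foldr partial (map (\<lambda>a. a * m + i a) [0..<n]) f p"
      by (rule multi_partial_indicator[OF U f p im])
    ultimately show "T (?\<delta> i) = foldr partial (map (\<lambda>a. a * m + i a) [0..<n]) f p *
     of_real (\<Prod>a<n. z (a * m + i a) - p (a * m + i a))"
      unfolding T_def 1 by simp
  qed
  finally show ?thesis .
qed

section \<open>Partial derivatives under changes of variables\<close>

text \<open>
  A function that vanishes on the slice through \<open>p\<close> on which the coordinates in \<open>K\<close> are fixed has
  vanishing derivatives at \<open>p\<close> in all the remaining directions.
\<close>

lemma foldr_partial_vanish:
  assumes U: "openin (Euclidean_space N) U" and "set rs \<subseteq> {..<N}" and "set rs \<inter> K = {}"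
    and "\<And>q. q \<in> U \<Longrightarrow> \<forall>r\<in>K. q r = v r \<Longrightarrow> f q = 0"
    and "p \<in> U" and "\<forall>r\<in>K. p r = v r"
  shows "foldr partial rs f p = 0"
  using assms(2,3,5,6)
proof (induction rs arbitrary: p)
  case (Cons r rs)
  have "partial r (foldr partial rs f) p = partial r (\<lambda>_. 0) p"
  proof (rule partial_cong_ev, rule eventually_mono)
    show "\<forall>\<^sub>F t in nhds (p r). p(r := t) \<in> U"
      by (rule eventually_update_in_open[OF U Cons.prems(3)]) (use Cons.prems in auto)
    show "foldr partial rs f (p(r := t)) = 0" if "p(r := t) \<in> U" for t
      by (rule Cons.IH[OF _ _ that]) (use Cons.prems in auto)
  qed
  also have "\<dots> = 0" by (simp add: partial_def)
  finally show ?case by simp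
qed (use assms(4) in auto)

lemma foldr_partial_mult_left:
  fixes f :: "(nat \<Rightarrow> real) \<Rightarrow> complex"
  assumes U: "openin (Euclidean_space N) U" and f: "\<And>k. Ck_on k N U f"
    and "set rs \<subseteq> {..<N}" and "p \<in> U"
  shows "foldr partial rs (\<lambda>q. c * f q) p = c * foldr partial rs f p"
  using assms(3,4)
proof (induction rs arbitrary: p)
  case (Cons r rs)
  have "partial r (foldr partial rs (\<lambda>q. c * f q)) p = partial r (\<lambda>q. c * foldr partial rs f q) p"
    by (rule partial_cong[OF U Cons.prems(2)]) (use Cons in auto)
  also have "\<dots> = c * partial r (foldr partial rs f) p"
  proof -
    have "((\<lambda>t. foldr partial rs f (p(r := t))) has_vector_derivative partial r (foldr partial rs f) p) (at (p r))"
      by (rule has_partial_at[OF U Ck_on_foldr_partial[OF _ f]]) (use Cons.prems in auto)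
    then have "((\<lambda>t. c * foldr partial rs f (p(r := t))) has_vector_derivative c * partial r (foldr partial rs f) p) (at (p r))"
      by (rule has_vector_derivative_mult_right)
    from vector_derivative_at[OF this] show ?thesis by (simp add: partial_def)
  qed
  finally show ?case by simp
qed simp

lemma partial_permute_coordinates:
  assumes "bij \<tau>"
  shows "partial (\<tau> r) (\<lambda>q. f (q \<circ> \<tau>)) p = partial r f (p \<circ> \<tau>)"
proof -
  have "(p(\<tau> r := t)) \<circ> \<tau> = (p \<circ> \<tau>)(r := t)" for t
    using bij_is_inj[OF assms] by (auto simp: fun_eq_iff inj_eq)
  then show ?thesis by (simp add: partial_def)
qed

text \<open>
  No differentiability is needed: a permutation of the coordinates identifies the difference quotients.
\<close>

lemma foldr_partial_permute_coordinates:
  assumes "bij \<tau>"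
  shows "foldr partial (map \<tau> rs) (\<lambda>q. f (q \<circ> \<tau>)) p = foldr partial rs f (p \<circ> \<tau>)"
proof (induction rs arbitrary: p)
  case (Cons r rs)
  then have eq: "foldr partial (map \<tau> rs) (\<lambda>q. f (q \<circ> \<tau>)) = (\<lambda>p. foldr partial rs f (p \<circ> \<tau>))" by (intro ext)
  have step: "foldr partial (map \<tau> (r # rs)) g p = partial (\<tau> r) (foldr partial (map \<tau> rs) g) p"
    for g :: "(nat \<Rightarrow> real) \<Rightarrow> 'a" by simp
  have step': "foldr partial (r # rs) f p' = partial r (foldr partial rs f) p'" for p' by simp
  show ?case unfolding step step' eq partial_permute_coordinates[OF assms] ..
qed simp

lemma openin_Euclidean_preimage:
  fixes G :: "(nat \<Rightarrow> real) \<Rightarrow> nat \<Rightarrow> real"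
  assumes B: "openin (Euclidean_space N) B" and H: "openin (Euclidean_space M) H"
    and G: "continuous_on B G" "\<And>q. q \<in> B \<Longrightarrow> G q \<in> topspace (Euclidean_space M)"
  shows "openin (Euclidean_space N) {q \<in> B. G q \<in> H}"
proof -
  obtain T where T: "open T" "H = {x. \<forall>i\<ge>M. x i = 0} \<inter> T"
    using H unfolding openin_Euclidean_eq openin_open by auto
  have "openin (top_of_set B) (B \<inter> G -` T)"
    using continuous_openin_preimage_gen[OF G(1) T(1)] .
  then have "openin (top_of_set {x. \<forall>i\<ge>N. x i = 0}) (B \<inter> G -` T)"
    using B unfolding openin_Euclidean_eq by (rule openin_trans)
  moreover have "B \<inter> G -` T = {q \<in> B. G q \<in> H}"
    using G(2) T by (auto simp: topspace_Euclidean_space)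
  ultimately show ?thesis unfolding openin_Euclidean_eq by simp
qed

section \<open>Smooth maps in charts\<close>

lemma smooth_manifold_chart:
  assumes "smooth_manifold M" and "(C, \<psi>) \<in> atlas M"
  shows "openin (mtop M) C" and "inj_on \<psi> C" and "\<psi> ` C \<subseteq> topspace (Euclidean_space (mdim M))"
proof -
  have "\<forall>(U, \<phi>)\<in>atlas M. is_chart M U \<phi>" using assms(1) by (simp add: smooth_manifold_def)
  from bspec[OF this assms(2)] have c: "is_chart M C \<psi>" by simp
  then show "openin (mtop M) C" by (simp add: is_chart_def)
  then have top: "topspace (subtopology (mtop M) C) = C" using openin_subset[of "mtop M" C] by auto
  have "homeomorphic_map (subtopology (mtop M) C) (subtopology (Euclidean_space (mdim M)) (\<psi> ` C)) \<psi>"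
    using c by (simp add: is_chart_def)
  from homeomorphic_imp_injective_map[OF this] show "inj_on \<psi> C" by (simp only: top)
  show "\<psi> ` C \<subseteq> topspace (Euclidean_space (mdim M))"
    using c openin_subset[of "Euclidean_space (mdim M)" "\<psi> ` C"] by (simp add: is_chart_def)
qed

text \<open>
  A smooth function composed with a parametrization \<open>T\<close> by an open set of a Euclidean space, where
  \<open>T\<close> takes its values in a single chart and is smooth there.
\<close>

lemma smooth_fun_compose_chart:
  assumes F: "smooth_fun M W F" and chart: "(C, \<psi>) \<in> atlas M" and inj: "inj_on \<psi> C"
    and E: "\<psi> ` C \<subseteq> topspace (Euclidean_space (mdim M))"
    and B: "openin (Euclidean_space N) B" and TC: "\<And>q. q \<in> B \<Longrightarrow> T q \<in> C"
    and sm: "\<And>i k. i < mdim M \<Longrightarrow> Ck_on k N B (\<lambda>q. \<psi> (T q) i)"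
    and \<xi>: "\<xi> \<in> B" "T \<xi> \<in> W"
  obtains B' where "openin (Euclidean_space N) B'" "\<xi> \<in> B'" "B' \<subseteq> B"
    "\<forall>q\<in>B'. T q \<in> W" "\<forall>k. Ck_on k N B' (\<lambda>q. F (T q))"
proof -
  define H where "H = \<psi> ` (W \<inter> C)"
  define h where "h = (\<lambda>q. F (inv_into C \<psi> q))"
  have "smooth_on (mdim M) H h"
    using F chart unfolding smooth_fun_def H_def h_def by blast
  then have H: "openin (Euclidean_space (mdim M)) H" and h: "\<And>k. Ck_on k (mdim M) H h"
    by (auto simp: smooth_on_def)
  have GE: "\<psi> (T q) \<in> topspace (Euclidean_space (mdim M))" if "q \<in> B" for q
    using E TC[OF that] by blast
  have contG: "continuous_on B (\<lambda>q. \<psi> (T q))"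
    by (rule continuous_on_into_Euclidean[OF GE]) (use sm Ck_on_continuous[OF B] in blast)+
  define B' where "B' = {q \<in> B. \<psi> (T q) \<in> H}"
  have B': "openin (Euclidean_space N) B'"
    unfolding B'_def by (rule openin_Euclidean_preimage[OF B H contG GE])
  have sub: "B' \<subseteq> B" by (auto simp: B'_def)
  have TW: "T q \<in> W" if "q \<in> B'" for q
    using that TC[of q] inj unfolding B'_def H_def by (auto dest: inj_onD)
  have "Ck_on k N B' (\<lambda>q. F (T q))" for k
  proof (rule Ck_on_cong[OF B'])
    show "Ck_on k N B' (\<lambda>q. h (\<psi> (T q)))"
      by (rule Ck_on_compose[OF B' H _ Ck_on_subset[OF sub sm] h]) (auto simp: B'_def)
    show "h (\<psi> (T q)) = F (T q)" if "q \<in> B'" for q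
      using that sub TC[of q] inj by (auto simp: h_def)
  qed
  moreover have "\<xi> \<in> B'" using \<xi> TC[OF \<xi>(1)] by (auto simp: B'_def H_def)
  ultimately show ?thesis by (intro that[OF B' _ sub] allI ballI TW)
qed

text \<open>
  Near \<open>y p\<close>, the inverse of local coordinates on \<open>S\<close> is a smooth parametrization with values in one
  chart of the ambient manifold, and it is continuous into the ambient topology.
\<close>

lemma local_coordinates_inverse_in_chart:
  assumes M: "smooth_manifold M" and y: "local_coordinates M S m U y" and p: "p \<in> U"
  obtains C \<psi> B where "(C, \<psi>) \<in> atlas M" "openin (Euclidean_space m) B" "y p \<in> B" "B \<subseteq> y ` U"
    "\<forall>q\<in>B. inv_into U y q \<in> C"
    "\<forall>i<mdim M. \<forall>k. Ck_on k m B (\<lambda>q. \<psi> (inv_into U y q) i)"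
    "\<forall>D. openin (mtop M) D \<longrightarrow> openin (Euclidean_space m) {q \<in> B. inv_into U y q \<in> D}"
proof -
  let ?I = "inv_into U y"
  let ?E = "topspace (Euclidean_space m)"
  have yU: "openin (subtopology (mtop M) S) U" "openin (Euclidean_space m) (y ` U)" "inj_on y U"
    "smooth_map_on (euclidean_manifold m) M (y ` U) ?I"
    using y by (auto simp: local_coordinates_def)
  have Ip: "?I (y p) = p" using p yU(3) by simp
  obtain W F where F: "y p \<in> W" "smooth_map (euclidean_manifold m) M W F" "\<And>q. q \<in> W \<inter> y ` U \<Longrightarrow> F q = ?I q"
    using yU(4) p unfolding smooth_map_on_def by (metis imageI)
  have W: "openin (Euclidean_space m) W" "continuous_map (subtopology (Euclidean_space m) W) (mtop M) F"
    using F(2) by (auto simp: smooth_map_def euclidean_manifold_def)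
  have Wsub: "topspace (subtopology (Euclidean_space m) W) = W" using openin_subset[OF W(1)] by auto
  have pre: "openin (Euclidean_space m) {q \<in> W. F q \<in> D}" if "openin (mtop M) D" for D
    using openin_continuous_map_preimage[OF W(2) that] Wsub openin_trans_full W(1) by metis
  have "p \<in> topspace (mtop M)" using p openin_subset[OF yU(1)] by auto
  then obtain C \<psi> where C: "(C, \<psi>) \<in> atlas M" "p \<in> C"
    using M unfolding smooth_manifold_def by blast
  define V where "V = {q \<in> W. F q \<in> C}"
  have V: "openin (Euclidean_space m) V"
    unfolding V_def using pre smooth_manifold_chart(1)[OF M C(1)] .
  define B where "B = V \<inter> y ` U"
  have B: "openin (Euclidean_space m) B" unfolding B_def using V yU(2) by (rule openin_Int)
  have FI: "F q = ?I q" if "q \<in> B" for q using that F(3) by (auto simp: B_def V_def)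
  have sm: "Ck_on k m B (\<lambda>q. \<psi> (?I q) i)" if i: "i < mdim M" for i k
  proof (rule Ck_on_cong[OF B])
    have "smooth_fun (euclidean_manifold m) V (\<lambda>q. \<psi> (F q) i)"
      using F(2) C(1) i unfolding smooth_map_def V_def by blast
    then have "smooth_on m ((\<lambda>q. q) ` (V \<inter> ?E)) (\<lambda>q. \<psi> (F (inv_into ?E (\<lambda>q. q) q)) i)"
      by (simp add: smooth_fun_def euclidean_manifold_def)
    moreover have "(\<lambda>q. q) ` (V \<inter> ?E) = V" using openin_subset[OF V] by auto
    ultimately have "Ck_on k m V (\<lambda>q. \<psi> (F (inv_into ?E (\<lambda>q. q) q)) i)"
      by (simp add: smooth_on_def)
    then show "Ck_on k m B (\<lambda>q. \<psi> (F (inv_into ?E (\<lambda>q. q) q)) i)"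
      by (rule Ck_on_subset[rotated]) (simp add: B_def)
    show "\<psi> (F (inv_into ?E (\<lambda>q. q) q)) i = \<psi> (?I q) i" if "q \<in> B" for q
    proof -
      have "q \<in> ?E" using that openin_subset[OF B] by blast
      then have "inv_into ?E (\<lambda>q. q) q = q" using inv_into_f_f[of "\<lambda>q. q" ?E q] by simp
      then show ?thesis using FI[OF that] by simp
    qed
  qed
  have "openin (Euclidean_space m) {q \<in> B. ?I q \<in> D}" if D: "openin (mtop M) D" for D
  proof -
    have "{q \<in> B. ?I q \<in> D} = B \<inter> {q \<in> W. F q \<in> D}" using FI by (auto simp: B_def V_def)
    then show ?thesis using openin_Int[OF B pre[OF D]] by simp
  qed
  moreover have "y p \<in> B" using F p Ip C by (auto simp: B_def V_def)
  moreover have "?I q \<in> C" if "q \<in> B" for q using that FI[OF that] by (auto simp: B_def V_def)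
  moreover have "B \<subseteq> y ` U" by (simp add: B_def)
  ultimately show ?thesis by (intro that[OF C(1) B] allI impI ballI sm)
qed

section \<open>Coordinate vectors are tangent vectors\<close>

lemma smooth_near_in_coordinates:
  fixes f :: "'a \<Rightarrow> real"
  assumes M: "smooth_manifold M" and y: "local_coordinates M S m U y" and p: "p \<in> U"
    and f: "smooth_near M S p f"
  shows "\<exists>B. openin (Euclidean_space m) B \<and> y p \<in> B \<and> (\<forall>k. Ck_on k m B (\<lambda>q. f (inv_into U y q)))"
proof -
  let ?I = "inv_into U y"
  have yU: "openin (subtopology (mtop M) S) U" "inj_on y U"
    using y by (auto simp: local_coordinates_def)
  have US: "U \<subseteq> S" using openin_subset[OF yU(1)] by auto
  have Ip: "?I (y p) = p" using p yU(2) by simp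
  obtain U' where U': "openin (subtopology (mtop M) S) U'" "p \<in> U'" "smooth_fun_on M U' f"
    using f unfolding smooth_near_def by blast
  obtain D where D: "openin (mtop M) D" "U' = D \<inter> S" using U'(1) unfolding openin_subtopology by blast
  obtain W F where F: "p \<in> W" "smooth_fun M W F" "\<And>q. q \<in> W \<inter> U' \<Longrightarrow> F q = f q"
    using U'(2,3) unfolding smooth_fun_on_def by metis
  obtain C \<psi> B where B: "(C, \<psi>) \<in> atlas M" "openin (Euclidean_space m) B" "y p \<in> B" "B \<subseteq> y ` U"
    "\<forall>q\<in>B. ?I q \<in> C"
    "\<forall>i<mdim M. \<forall>k. Ck_on k m B (\<lambda>q. \<psi> (?I q) i)"
    "\<forall>D. openin (mtop M) D \<longrightarrow> openin (Euclidean_space m) {q \<in> B. ?I q \<in> D}"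
    by (rule local_coordinates_inverse_in_chart[OF M y p], rule that)
  have "?I (y p) \<in> W" using Ip F(1) by simp
  then obtain B' where B': "openin (Euclidean_space m) B'" "y p \<in> B'" "B' \<subseteq> B"
    "\<forall>q\<in>B'. ?I q \<in> W" "\<forall>k. Ck_on k m B' (\<lambda>q. F (?I q))"
    using smooth_fun_compose_chart[OF F(2) B(1) smooth_manifold_chart(2,3)[OF M B(1)] B(2) _ _ B(3), of ?I] B(5,6)
    by blast
  let ?B = "B' \<inter> {q \<in> B. ?I q \<in> D}"
  have O: "openin (Euclidean_space m) ?B" using B'(1) B(7)[rule_format, OF D(1)] by (rule openin_Int)
  have "Ck_on k m ?B (\<lambda>q. f (?I q))" for k
  proof (rule Ck_on_cong[OF O])
    show "Ck_on k m ?B (\<lambda>q. F (?I q))" using B'(5)[rule_format, of k] by (rule Ck_on_subset[rotated]) auto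
    fix q assume q: "q \<in> ?B"
    then have "?I q \<in> U" using B(4) by (auto intro: inv_into_into)
    then show "F (?I q) = f (?I q)" using q B'(4) F(3) D(2) US by auto
  qed
  moreover have "y p \<in> ?B" using B' B(3) Ip U'(2) D(2) by auto
  ultimately show ?thesis using O by blast
qed

lemma coord_vector_in_tangent_space:
  assumes M: "smooth_manifold M" and y: "local_coordinates M S m U y" and p: "p \<in> U" and i: "i < m"
  shows "coord_vector U y p i \<in> tangent_space M S p"
proof -
  let ?I = "inv_into U y" and ?V = "coord_vector U y p i"
  have yU: "openin (subtopology (mtop M) S) U" "inj_on y U"
    using y by (auto simp: local_coordinates_def)
  have US: "U \<subseteq> S" using openin_subset[OF yU(1)] by auto
  have Ip: "?I (y p) = p" using p yU(2) by simp
  have der: "((\<lambda>t. f (?I ((y p)(i := t)))) has_vector_derivative ?V f) (at (y p i))"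
    if f: "smooth_near M S p f" for f
  proof -
    obtain B where B: "openin (Euclidean_space m) B" "y p \<in> B" "\<And>k. Ck_on k m B (\<lambda>q. f (?I q))"
      using smooth_near_in_coordinates[OF M y p f] by blast
    show ?thesis unfolding coord_vector_def by (rule has_partial_at[OF B(1,3) i B(2)])
  qed
  have add: "?V (\<lambda>h. f h + g h) = ?V f + ?V g"
    and mult: "?V (\<lambda>h. f h * g h) = f p * ?V g + g p * ?V f"
    if f: "smooth_near M S p f" and g: "smooth_near M S p g" for f g
  proof -
    from vector_derivative_at[OF has_vector_derivative_add[OF der[OF f] der[OF g]]]
    show "?V (\<lambda>h. f h + g h) = ?V f + ?V g" by (simp add: coord_vector_def partial_def)
    from vector_derivative_at[OF has_vector_derivative_mult[OF der[OF f] der[OF g]]]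
    show "?V (\<lambda>h. f h * g h) = f p * ?V g + g p * ?V f"
      by (simp add: coord_vector_def partial_def Ip mult.commute)
  qed
  have scale: "?V (\<lambda>h. c * f h) = c * ?V f" if f: "smooth_near M S p f" for f c
    using vector_derivative_at[OF has_vector_derivative_mult_right[OF der[OF f], of c]]
    by (simp add: coord_vector_def partial_def)
  have loc: "?V f = ?V g"
    if U': "openin (subtopology (mtop M) S) U'" "p \<in> U'" "\<forall>h\<in>U'. f h = g h" for f g U'
  proof -
    obtain D where D: "openin (mtop M) D" "U' = D \<inter> S" using U'(1) unfolding openin_subtopology by blast
    obtain C \<psi> B where "(C, \<psi>) \<in> atlas M" "openin (Euclidean_space m) B"
      and B: "y p \<in> B" "B \<subseteq> y ` U"
      and "\<forall>q\<in>B. ?I q \<in> C" "\<forall>i<mdim M. \<forall>k. Ck_on k m B (\<lambda>q. \<psi> (?I q) i)"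
      and pre: "\<forall>D. openin (mtop M) D \<longrightarrow> openin (Euclidean_space m) {q \<in> B. ?I q \<in> D}"
      by (rule local_coordinates_inverse_in_chart[OF M y p], rule that)
    show ?thesis unfolding coord_vector_def
    proof (rule partial_cong[OF pre[rule_format, OF D(1)] _ i])
      show "y p \<in> {q \<in> B. ?I q \<in> D}" using B(1) Ip U'(2) D(2) by simp
      fix q assume q: "q \<in> {q \<in> B. ?I q \<in> D}"
      then have "?I q \<in> U" using B(2) by (auto intro: inv_into_into)
      then show "f (?I q) = g (?I q)" using q US D(2) U'(3) by auto
    qed
  qed
  show ?thesis unfolding tangent_space_def using add mult scale loc by blast
qed

section \<open>Coordinates on powers\<close>

text \<open>
  The \<open>j\<close>-th of the blocks of \<open>m\<close> coordinates that make up \<open>q\<close>, extended by zero to a point of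
  \<^const>\<open>Euclidean_space\<close> \<open>m\<close>. It undoes \<^const>\<open>concat_blocks\<close>.
\<close>

definition coord_block :: "nat \<Rightarrow> (nat \<Rightarrow> real) \<Rightarrow> nat \<Rightarrow> nat \<Rightarrow> real" where
  "coord_block m q j = (\<lambda>i. if i < m then q (j * m + i) else 0)"

lemma coord_block_concat_blocks:
  assumes "j < n" and "v j \<in> topspace (Euclidean_space m)"
  shows "coord_block m (concat_blocks n m v) j = v j"
  using assms block_index_less[of j n _ m]
  by (auto simp: coord_block_def concat_blocks_def fun_eq_iff topspace_Euclidean_space)

lemma concat_blocks_coord_block:
  assumes "q \<in> topspace (Euclidean_space (n * m))"
  shows "concat_blocks n m (coord_block m q) = q"
proof
  fix r
  show "concat_blocks n m (coord_block m q) r = q r"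
  proof (cases "r < n * m")
    case True
    then have "r mod m < m" by (intro mod_less_divisor) (cases m; simp)
    then show ?thesis using True by (simp add: concat_blocks_def coord_block_def)
  qed (use assms in \<open>simp add: concat_blocks_def topspace_Euclidean_space\<close>)
qed

lemma concat_blocks_in_Euclidean: "concat_blocks n m v \<in> topspace (Euclidean_space (n * m))"
  by (simp add: concat_blocks_def topspace_Euclidean_space)

lemma inj_on_power_coords:
  assumes "inj_on y U" and "y ` U \<subseteq> topspace (Euclidean_space m)"
  shows "inj_on (power_coords n m (\<lambda>_. y)) (Pi\<^sub>E {..<n} (\<lambda>_. U))"
proof (rule inj_onI)
  fix g h assume g: "g \<in> Pi\<^sub>E {..<n} (\<lambda>_. U)" and h: "h \<in> Pi\<^sub>E {..<n} (\<lambda>_. U)"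
    and eq: "power_coords n m (\<lambda>_. y) g = power_coords n m (\<lambda>_. y) h"
  show "g = h"
  proof (rule PiE_ext[OF g h])
    fix j assume j: "j \<in> {..<n}"
    then have U: "g j \<in> U" "h j \<in> U" using g h by auto
    have "coord_block m (power_coords n m (\<lambda>_. y) g) j = y (g j)"
      unfolding power_coords_def by (rule coord_block_concat_blocks) (use j U assms(2) in auto)
    moreover have "coord_block m (power_coords n m (\<lambda>_. y) h) j = y (h j)"
      unfolding power_coords_def by (rule coord_block_concat_blocks) (use j U assms(2) in auto)
    ultimately have "y (g j) = y (h j)" using eq by simp
    then show "g j = h j" using assms(1) U by (auto dest: inj_onD)
  qed
qed

lemma coord_block_in_Euclidean: "coord_block m q j \<in> topspace (Euclidean_space m)"
  by (simp add: coord_block_def topspace_Euclidean_space)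

lemma openin_all_coord_blocks:
  assumes B: "openin (Euclidean_space m) B"
  shows "openin (Euclidean_space (n * m))
    {q \<in> topspace (Euclidean_space (n * m)). \<forall>j<n. coord_block m q j \<in> B}"
proof -
  let ?E = "topspace (Euclidean_space (n * m))"
  have "openin (Euclidean_space (n * m)) {q \<in> ?E. coord_block m q j \<in> B}" for j
  proof (rule openin_Euclidean_preimage[OF _ B])
    have "continuous_on ?E (\<lambda>q. coord_block m q j i)" if "i < m" for i
      using that continuous_on_subset[OF continuous_on_product_coordinates, of ?E]
      by (simp add: coord_block_def)
    then show "continuous_on ?E (\<lambda>q. coord_block m q j)"
      by (intro continuous_on_into_Euclidean[OF coord_block_in_Euclidean])
  qed (auto intro: coord_block_in_Euclidean)
  then have "openin (Euclidean_space (n * m))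
      (\<Inter> (insert ?E ((\<lambda>j. {q \<in> ?E. coord_block m q j \<in> B}) ` {..<n})))"
    by (intro openin_Inter) auto
  moreover have "\<Inter> (insert ?E ((\<lambda>j. {q \<in> ?E. coord_block m q j \<in> B}) ` {..<n}))
      = {q \<in> ?E. \<forall>j<n. coord_block m q j \<in> B}" by auto
  ultimately show ?thesis by simp
qed

lemma power_chart:
  assumes M: "smooth_manifold M" and C: "(C, \<psi>) \<in> atlas M"
  shows "(Pi\<^sub>E {..<n} (\<lambda>_. C), power_coords n (mdim M) (\<lambda>_. \<psi>)) \<in> atlas (power_manifold M n)"
    and "inj_on (power_coords n (mdim M) (\<lambda>_. \<psi>)) (Pi\<^sub>E {..<n} (\<lambda>_. C))"
    and "power_coords n (mdim M) (\<lambda>_. \<psi>) ` Pi\<^sub>E {..<n} (\<lambda>_. C)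
      \<subseteq> topspace (Euclidean_space (mdim (power_manifold M n)))"
proof -
  have "\<exists>c. (Pi\<^sub>E {..<n} (\<lambda>_. C), power_coords n (mdim M) (\<lambda>_. \<psi>))
      = (Pi\<^sub>E {..<n} (\<lambda>j. fst (c j)), power_coords n (mdim M) (\<lambda>j. snd (c j))) \<and> (\<forall>j<n. c j \<in> atlas M)"
    by (rule exI[of _ "\<lambda>_. (C, \<psi>)"]) (use C in simp)
  then show "(Pi\<^sub>E {..<n} (\<lambda>_. C), power_coords n (mdim M) (\<lambda>_. \<psi>)) \<in> atlas (power_manifold M n)"
    by (simp add: power_manifold_def)
  show "inj_on (power_coords n (mdim M) (\<lambda>_. \<psi>)) (Pi\<^sub>E {..<n} (\<lambda>_. C))"
    by (rule inj_on_power_coords[OF smooth_manifold_chart(2,3)[OF M C]])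
  show "power_coords n (mdim M) (\<lambda>_. \<psi>) ` Pi\<^sub>E {..<n} (\<lambda>_. C)
      \<subseteq> topspace (Euclidean_space (mdim (power_manifold M n)))"
    using concat_blocks_in_Euclidean by (auto simp: power_coords_def power_manifold_def)
qed

text \<open>
  A smooth function on the power of a manifold is a smooth function of the blocks of local coordinates,
  near the point all of whose blocks are \<open>y p\<close>.
\<close>

lemma smooth_fun_on_power_in_coordinates:
  fixes \<Omega> :: "(nat \<Rightarrow> 'a) \<Rightarrow> 'b::real_normed_vector"
  assumes M: "smooth_manifold M" and y: "local_coordinates M S m U y" and p: "p \<in> U"
    and \<Omega>: "smooth_fun_on (power_manifold M n) A \<Omega>" and A: "Pi\<^sub>E {..<n} (\<lambda>_. U) \<subseteq> A"
  shows "\<exists>Q. openin (Euclidean_space (n * m)) Q \<and> concat_blocks n m (\<lambda>_. y p) \<in> Q \<and>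
    (\<forall>q\<in>Q. \<forall>j<n. coord_block m q j \<in> y ` U) \<and>
    (\<forall>k. Ck_on k (n * m) Q (\<lambda>q. \<Omega> (\<lambda>j\<in>{..<n}. inv_into U y (coord_block m q j))))"
proof -
  let ?I = "inv_into U y" and ?P = "concat_blocks n m (\<lambda>_. y p)"
  let ?T = "\<lambda>q. \<lambda>j\<in>{..<n}. inv_into U y (coord_block m q j)"
  have yU: "openin (Euclidean_space m) (y ` U)" "inj_on y U"
    using y by (auto simp: local_coordinates_def)
  have Ip: "?I (y p) = p" using p yU(2) by simp
  have "y p \<in> topspace (Euclidean_space m)" using openin_subset[OF yU(1)] p by blast
  then have blkP: "coord_block m ?P j = y p" if "j < n" for j
    using coord_block_concat_blocks[OF that, of "\<lambda>_. y p" m] by simp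
  obtain C \<psi> B where B: "(C, \<psi>) \<in> atlas M" "openin (Euclidean_space m) B" "y p \<in> B" "B \<subseteq> y ` U"
    "\<forall>q\<in>B. ?I q \<in> C" "\<forall>i<mdim M. \<forall>k. Ck_on k m B (\<lambda>q. \<psi> (?I q) i)"
    and "\<forall>D. openin (mtop M) D \<longrightarrow> openin (Euclidean_space m) {q \<in> B. ?I q \<in> D}"
    by (rule local_coordinates_inverse_in_chart[OF M y p], rule that)
  define B1 where "B1 = {q \<in> topspace (Euclidean_space (n * m)). \<forall>j<n. coord_block m q j \<in> B}"
  have B1: "openin (Euclidean_space (n * m)) B1" unfolding B1_def by (rule openin_all_coord_blocks[OF B(2)])
  have TC: "?T q \<in> Pi\<^sub>E {..<n} (\<lambda>_. C)" if "q \<in> B1" for q using that B(5) by (auto simp: B1_def)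
  have TA: "?T q \<in> A" if "q \<in> B1" for q
  proof -
    have "coord_block m q j \<in> y ` U" if "j < n" for j
      using that \<open>q \<in> B1\<close> B(4) by (auto simp: B1_def)
    then have "?T q \<in> Pi\<^sub>E {..<n} (\<lambda>_. U)" by (auto intro: inv_into_into)
    then show ?thesis using A by blast
  qed
  have PB: "?P \<in> B1" using blkP B(3) concat_blocks_in_Euclidean by (simp add: B1_def)
  obtain W F where F: "?T ?P \<in> W" "smooth_fun (power_manifold M n) W F" "\<forall>g\<in>W \<inter> A. F g = \<Omega> g"
    using \<Omega> TA[OF PB] unfolding smooth_fun_on_def by blast
  have sm: "Ck_on k (n * m) B1 (\<lambda>q. power_coords n (mdim M) (\<lambda>_. \<psi>) (?T q) r)"
    if r: "r < mdim (power_manifold M n)" for r k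
  proof -
    have r': "r < n * mdim M" using r by (simp add: power_manifold_def)
    define a l where "a = r div mdim M" and "l = r mod mdim M"
    have a: "a < n" using r' by (simp add: a_def less_mult_imp_div_less)
    have l: "l < mdim M" unfolding l_def using r' by (intro mod_less_divisor) (cases "mdim M"; simp)
    have "Ck_on k (n * m) B1 (\<lambda>q. \<psi> (?I (coord_block m q a)) l)"
    proof (rule Ck_on_compose[OF B1 B(2), of "\<lambda>q. coord_block m q a" k "\<lambda>\<xi>. \<psi> (?I \<xi>) l"])
      show "coord_block m q a \<in> B" if "q \<in> B1" for q using that a by (simp add: B1_def)
      show "Ck_on k (n * m) B1 (\<lambda>q. coord_block m q a j)" if "j < m" for j
        using that Ck_on_coord[OF B1] by (simp add: coord_block_def)
      show "Ck_on k m B (\<lambda>q. \<psi> (?I q) l)" using B(6) l by blast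
    qed
    moreover have "(\<lambda>q. power_coords n (mdim M) (\<lambda>_. \<psi>) (?T q) r) = (\<lambda>q. \<psi> (?I (coord_block m q a)) l)"
      using r' a by (simp add: power_coords_def concat_blocks_def a_def l_def)
    ultimately show ?thesis by simp
  qed
  obtain Q where Q: "openin (Euclidean_space (n * m)) Q" "?P \<in> Q" "Q \<subseteq> B1"
    "\<forall>q\<in>Q. ?T q \<in> W" "\<forall>k. Ck_on k (n * m) Q (\<lambda>q. F (?T q))"
    using smooth_fun_compose_chart[where T = ?T, OF F(2) power_chart[OF M B(1)] B1 _ _ PB F(1)] TC sm
    by blast
  have "Ck_on k (n * m) Q (\<lambda>q. \<Omega> (?T q))" for k
  proof (rule Ck_on_cong[OF Q(1)])
    show "Ck_on k (n * m) Q (\<lambda>q. F (?T q))" using Q(5) by blast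
    show "F (?T q) = \<Omega> (?T q)" if "q \<in> Q" for q using that Q(3,4) F(3) TA by blast
  qed
  moreover have "\<forall>q\<in>Q. \<forall>j<n. coord_block m q j \<in> y ` U" using Q(3) B(4) unfolding B1_def by blast
  ultimately show ?thesis using Q(1,2) by blast
qed

section \<open>Permutations of the blocks\<close>

text \<open>
  For a permutation \<open>\<sigma>\<close> of \<open>{..<n}\<close>, the permutation of the coordinate positions \<open>{..<n * m}\<close> that
  moves the block \<open>a\<close> to the block \<open>\<sigma> a\<close>; positions from \<open>n * m\<close> on stay fixed.
\<close>

definition block_permutation :: "nat \<Rightarrow> nat \<Rightarrow> (nat \<Rightarrow> nat) \<Rightarrow> nat \<Rightarrow> nat" where
  "block_permutation n m \<sigma> r = (if r < n * m then \<sigma> (r div m) * m + r mod m else r)"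

lemma block_permutation_index:
  "a < n \<Longrightarrow> l < m \<Longrightarrow> block_permutation n m \<sigma> (a * m + l) = \<sigma> a * m + l"
  using block_index_less[of a n l m] by (simp add: block_permutation_def)

lemma block_permutation_inverse:
  assumes "\<And>a. a < n \<Longrightarrow> \<sigma> a < n" and "\<And>a. a < n \<Longrightarrow> \<sigma>' (\<sigma> a) = a"
  shows "block_permutation n m \<sigma>' (block_permutation n m \<sigma> r) = r"
proof (cases "r < n * m")
  case True
  have l: "r mod m < m" using True by (intro mod_less_divisor) (cases m; simp)
  have a: "r div m < n" using True by (simp add: less_mult_imp_div_less)
  have "block_permutation n m \<sigma> r = \<sigma> (r div m) * m + r mod m" using True by (simp add: block_permutation_def)
  then show ?thesis using block_permutation_index[OF assms(1)[OF a] l, of \<sigma>'] assms(2)[OF a] by simp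
qed (simp add: block_permutation_def)

lemma bij_block_permutation:
  assumes "\<sigma> permutes {..<n}"
  shows "bij (block_permutation n m \<sigma>)"
proof (rule o_bij)
  have 1: "\<sigma> a < n" "inv_into UNIV \<sigma> a < n" if "a < n" for a
    using that permutes_in_image[OF assms] permutes_in_image[OF permutes_inv[OF assms]] by auto
  show "block_permutation n m (inv_into UNIV \<sigma>) \<circ> block_permutation n m \<sigma> = id"
    using 1 permutes_inverses[OF assms] by (auto simp: fun_eq_iff intro: block_permutation_inverse)
  show "block_permutation n m \<sigma> \<circ> block_permutation n m (inv_into UNIV \<sigma>) = id"
    using 1 permutes_inverses[OF assms] by (auto simp: fun_eq_iff intro: block_permutation_inverse)
qed

lemma coord_block_permute:
  assumes "j < n"
  shows "coord_block m (q \<circ> block_permutation n m \<sigma>) j = coord_block m q (\<sigma> j)"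
  using assms by (auto simp: coord_block_def fun_eq_iff block_permutation_index)

text \<open>
  Let \<open>f\<close> be multiplied by \<open>c\<close> when its blocks are permuted by \<open>\<sigma>\<close>, and let \<open>P\<close> be invariant. Permuting the variables moves
  the directions of differentiation to other blocks, which after reordering is the permutation of
  the directions by \<open>\<sigma>\<close>.
\<close>

lemma foldr_partial_permute_blocks:
  fixes f :: "(nat \<Rightarrow> real) \<Rightarrow> complex"
  assumes Q: "openin (Euclidean_space (n * m)) Q" and f: "\<And>k. Ck_on k (n * m) Q f" and P: "P \<in> Q"
    and \<sigma>: "\<sigma> permutes {..<n}" and i: "\<And>a. a < n \<Longrightarrow> i a < m"
    and P_\<sigma>: "P \<circ> block_permutation n m \<sigma> = P"
    and eq: "\<And>q. q \<in> Q \<Longrightarrow> f (q \<circ> block_permutation n m \<sigma>) = c * f q"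
  shows "foldr partial (map (\<lambda>a. a * m + i (\<sigma> a)) [0..<n]) f P
    = c * foldr partial (map (\<lambda>a. a * m + i a) [0..<n]) f P"
proof -
  let ?\<tau> = "block_permutation n m \<sigma>"
  let ?xs = "map (\<lambda>a. a * m + i (\<sigma> a)) [0..<n]" and ?ys = "map (\<lambda>a. a * m + i a) [0..<n]"
  have \<sigma>n: "\<sigma> a < n" if "a < n" for a using that permutes_in_image[OF \<sigma>] by auto
  have map: "map ?\<tau> ?xs = map (\<lambda>a. a * m + i a) (map \<sigma> [0..<n])"
    using \<sigma>n i by (auto simp: block_permutation_index)
  have "mset (map \<sigma> [0..<n]) = mset [0..<n]"
    using permutes_image_mset[OF \<sigma>] by (simp add: lessThan_atLeast0)
  then have ms: "mset (map ?\<tau> ?xs) = mset ?ys" unfolding map by (metis mset_map)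
  have sub: "set (map ?\<tau> ?xs) \<subseteq> {..<n * m}"
    unfolding map using \<sigma>n i block_index_less by auto
  have "foldr partial ?xs f P = foldr partial ?xs f (P \<circ> ?\<tau>)" by (simp only: P_\<sigma>)
  also have "\<dots> = foldr partial (map ?\<tau> ?xs) (\<lambda>q. f (q \<circ> ?\<tau>)) P"
    by (rule foldr_partial_permute_coordinates[OF bij_block_permutation[OF \<sigma>], symmetric])
  also have "\<dots> = foldr partial (map ?\<tau> ?xs) (\<lambda>q. c * f q) P"
    by (rule foldr_partial_cong[OF Q eq sub P])
  also have "\<dots> = c * foldr partial (map ?\<tau> ?xs) f P"
    by (rule foldr_partial_mult_left[OF Q f sub P])
  also have "foldr partial (map ?\<tau> ?xs) f P = foldr partial ?ys f P"
    by (rule foldr_partial_mset_eq[OF Q f ms sub P])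
  finally show ?thesis .
qed

section \<open>The van Est map in coordinates\<close>

text \<open>
  The vectors act from the last argument to the first. After \<open>n - k\<close> of them have been applied, the
  remaining expression \<open>F\<close> depends on the first \<open>k\<close> arguments only. It is compared with a function
  \<open>\<phi>\<close> of all the coordinates, at points whose blocks from the \<open>k\<close>-th on are the base point \<open>y0\<close>.
\<close>

lemma iterated_derivative_eq_foldr_partial:
  assumes Q: "openin (Euclidean_space (n * m)) Q" and P: "P \<in> Q" "\<And>j. j < n \<Longrightarrow> coord_block m P j = y0"
    and i: "\<And>j. j < n \<Longrightarrow> i j < m"
    and V: "\<And>j f. j < n \<Longrightarrow> V j f = partial (i j) (\<lambda>q. f (I q)) y0"
    and "k \<le> n" and "Ck_on k (n * m) Q \<phi>"
    and "\<And>q. q \<in> Q \<Longrightarrow> \<forall>j. k \<le> j \<and> j < n \<longrightarrow> coord_block m q j = y0 \<Longrightarrow>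
      F (\<lambda>j. if j < k then I (coord_block m q j) else undefined) = \<phi> q"
  shows "iterated_derivative V k F = foldr partial (map (\<lambda>j. j * m + i j) [0..<k]) \<phi> P"
  using assms(6-8)
proof (induction k arbitrary: F \<phi>)
  case 0
  then show ?case using P by simp
next
  case (Suc k)
  let ?r = "k * m + i k"
  have k: "k < n" using Suc.prems(1) by simp
  have r: "?r < n * m" using block_index_less[OF k i[OF k]] .
  have "iterated_derivative V k (\<lambda>g. complexify (V k) (\<lambda>h. F (g(k := h))))
      = foldr partial (map (\<lambda>j. j * m + i j) [0..<k]) (partial ?r \<phi>) P"
  proof (rule Suc.IH)
    show "k \<le> n" using k by simp
    show "Ck_on k (n * m) Q (partial ?r \<phi>)" using Ck_on_partial[OF Suc.prems(2) r] .
    fix q assume q: "q \<in> Q" "\<forall>j. k \<le> j \<and> j < n \<longrightarrow> coord_block m q j = y0"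
    let ?g = "\<lambda>j. if j < k then I (coord_block m q j) else undefined"
    have qr: "q ?r = y0 (i k)" 
      using fun_cong[OF q(2)[rule_format, of k], of "i k"] k i[OF k] by (simp add: coord_block_def)
    have "coord_block m q k = y0" using q(2) k by simp
    moreover have "coord_block m (q(?r := t)) j
        = (if j = k then (coord_block m q k)(i k := t) else coord_block m q j)" for t j
      using i[OF k] by (auto simp: coord_block_def fun_eq_iff block_index_eq_iff)
    ultimately have blk: "coord_block m (q(?r := t)) j = (if j = k then y0(i k := t) else coord_block m q j)" for t j
      by simp
    have "\<forall>\<^sub>F t in nhds (q ?r). q(?r := t) \<in> Q" by (rule eventually_update_in_open[OF Q q(1) r])
    then have ev: "\<forall>\<^sub>F t in nhds (y0 (i k)). \<phi> (q(?r := t)) = F (?g(k := I (y0(i k := t))))"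
      unfolding qr
    proof (rule eventually_mono)
      fix t assume t: "q(?r := t) \<in> Q"
      have "F (\<lambda>j. if j < Suc k then I (coord_block m (q(?r := t)) j) else undefined) = \<phi> (q(?r := t))"
        by (rule Suc.prems(3)[OF t], unfold blk) (use q(2) in simp)
      moreover have "(\<lambda>j. if j < Suc k then I (coord_block m (q(?r := t)) j) else undefined)
          = ?g(k := I (y0(i k := t)))"
        unfolding blk by (auto simp: fun_eq_iff)
      ultimately show "\<phi> (q(?r := t)) = F (?g(k := I (y0(i k := t))))" by simp
    qed
    have "((\<lambda>t. \<phi> (q(?r := t))) has_vector_derivative partial ?r \<phi> q) (at (y0 (i k)))"
      using has_partial_at[OF Q Suc.prems(2) r q(1)] unfolding qr .
    then have der: "((\<lambda>t. F (?g(k := I (y0(i k := t))))) has_vector_derivative partial ?r \<phi> q) (at (y0 (i k)))"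
      by (rule has_vector_derivative_cong_ev[THEN iffD1, rotated 2])
        (use ev eventually_nhds_x_imp_x[OF ev] in auto)
    have "V k (\<lambda>h. Re (F (?g(k := h)))) = Re (partial ?r \<phi> q)"
      using vector_derivative_at[OF bounded_linear.has_vector_derivative[OF bounded_linear_Re der]]
      by (simp add: V[OF k] partial_def)
    moreover have "V k (\<lambda>h. Im (F (?g(k := h)))) = Im (partial ?r \<phi> q)"
      using vector_derivative_at[OF bounded_linear.has_vector_derivative[OF bounded_linear_Im der]]
      by (simp add: V[OF k] partial_def)
    ultimately show "complexify (V k) (\<lambda>h. F (?g(k := h))) = partial ?r \<phi> q"
      by (simp add: complexify_def)
  qed
  then show ?case by simp
qed

lemma Alt_antisymmetric:
  assumes "antisymmetric \<Gamma> n \<Omega>" and "g \<in> common_source \<Gamma> n"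
  shows "Alt n \<Omega> g = \<Omega> g"
proof -
  have "of_int (sign \<sigma>) * \<Omega> (\<lambda>j. g (\<sigma> j)) = \<Omega> g" if "\<sigma> permutes {..<n}" for \<sigma>
  proof -
    have "\<Omega> (\<lambda>j. g (\<sigma> j)) = of_int (sign \<sigma>) * \<Omega> g"
      using assms that unfolding antisymmetric_def by blast
    moreover have "of_int (sign \<sigma>) * (of_int (sign \<sigma>) :: complex) = 1"
      by (simp flip: of_int_mult)
    ultimately show ?thesis by (simp flip: mult.assoc)
  qed
  then have "(\<Sum>\<sigma> | \<sigma> permutes {..<n}. of_int (sign \<sigma>) * \<Omega> (\<lambda>j. g (\<sigma> j)))
      = (\<Sum>\<sigma> | \<sigma> permutes {..<n}. \<Omega> g)" by (intro sum.cong) auto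
  also have "\<dots> = fact n * \<Omega> g"
    using card_permutations[of "{..<n}" n] by simp
  finally show ?thesis by (simp add: Alt_def)
qed

section \<open>The Taylor polynomial of an antisymmetric cochain\<close>

theorem lemma1p3:
  fixes \<Gamma> :: "('g, 'x) groupoid_data"
    and \<Omega> :: "(nat \<Rightarrow> 'g) \<Rightarrow> complex"
    and n m :: nat
    and x :: 'x
    and U :: "'g set"
    and y :: "'g \<Rightarrow> nat \<Rightarrow> real"
  assumes "lie_groupoid \<Gamma>"
    and "n \<ge> 1"
    and "cochain \<Gamma> n \<Omega>"
    and "normalized \<Gamma> n \<Omega>"
    and "antisymmetric \<Gamma> n \<Omega>"
    and "x \<in> Obj \<Gamma>"
    and "local_coordinates (arrows \<Gamma>) (source_fiber \<Gamma> x) m U y"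
    and "idn \<Gamma> x \<in> U"
  shows "(\<forall>i<m. coord_vector U y (idn \<Gamma> x) i \<in> algebroid_fiber \<Gamma> x) \<and>
    (\<forall>z :: nat \<Rightarrow> nat \<Rightarrow> real.
       taylor_poly (n * m) n
         (\<lambda>q. \<Omega> (inv_into (Pi\<^sub>E {..<n} (\<lambda>_. U)) (power_coords n m (\<lambda>_. y)) q))
         (power_coords n m (\<lambda>_. y) (\<lambda>j\<in>{..<n}. idn \<Gamma> x))
         (concat_blocks n m z) =
       (\<Sum>i \<in> {i \<in> {..<n} \<rightarrow>\<^sub>E {..<m}. strict_mono_on {..<n} i}.
          1 / fact n * van_Est n \<Omega> (\<lambda>j. coord_vector U y (idn \<Gamma> x) (i j)) *
          of_real (Vol_simplex n (\<lambda>b. y (idn \<Gamma> x) (i b)) (\<lambda>a b. z a (i b)))))"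
proof -
  define p where "p = idn \<Gamma> x"
  define I where "I = inv_into U y"
  define P where "P = power_coords n m (\<lambda>_. y) (\<lambda>j\<in>{..<n}. idn \<Gamma> x)"
  define T where "T q = (\<lambda>j\<in>{..<n}. I (coord_block m q j))" for q
  define f where "f q = \<Omega> (T q)" for q
  define V where "V i j = coord_vector U y (idn \<Gamma> x) (i j)" for i :: "nat \<Rightarrow> nat" and j
  define c where "c i = foldr partial (map (\<lambda>a. a * m + i a) [0..<n]) f P" for i
  have M: "smooth_manifold (arrows \<Gamma>)" using assms(1) by (simp add: lie_groupoid_def)
  note y = assms(7)
  have yU: "openin (subtopology (mtop (arrows \<Gamma>)) (source_fiber \<Gamma> x)) U"
    "openin (Euclidean_space m) (y ` U)" "inj_on y U"
    using y by (auto simp: local_coordinates_def)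
  have yE: "y ` U \<subseteq> topspace (Euclidean_space m)" using openin_subset[OF yU(2)] .
  have US: "U \<subseteq> source_fiber \<Gamma> x" using openin_subset[OF yU(1)] by auto
  have pU: "p \<in> U" using assms(8) by (simp add: p_def)
  have Ip: "I (y p) = p" using pU yU(3) by (simp add: I_def)
  have yp: "y p \<in> topspace (Euclidean_space m)" using pU yE by blast
  have P: "P = concat_blocks n m (\<lambda>_. y p)"
    unfolding P_def power_coords_def concat_blocks_def p_def
    by (auto simp: fun_eq_iff less_mult_imp_div_less)
  have blkP: "coord_block m P j = y p" if "j < n" for j
    unfolding P by (rule coord_block_concat_blocks[OF that yp])
  have CS: "Pi\<^sub>E {..<n} (\<lambda>_. U) \<subseteq> common_source \<Gamma> n"
  proof
    fix g assume g: "g \<in> Pi\<^sub>E {..<n} (\<lambda>_. U)"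
    have "g j \<in> Arr \<Gamma> \<and> src \<Gamma> (g j) = x" if "j < n" for j
      using g that US by (auto simp: source_fiber_def)
    then show "g \<in> common_source \<Gamma> n" using g by (auto simp: common_source_def PiE_iff)
  qed
  obtain Q where Q: "openin (Euclidean_space (n * m)) Q" "P \<in> Q"
    "\<forall>q\<in>Q. \<forall>j<n. coord_block m q j \<in> y ` U" "\<And>k. Ck_on k (n * m) Q f"
    using smooth_fun_on_power_in_coordinates[OF M y pU assms(3)[unfolded cochain_def] CS]
    unfolding P f_def T_def I_def by blast
  have TU: "T q \<in> Pi\<^sub>E {..<n} (\<lambda>_. U)" if "q \<in> Q" for q
    using that Q(3) by (auto simp: T_def I_def intro: inv_into_into)
  have TS: "T q \<in> common_source \<Gamma> n" if "q \<in> Q" for q using TU[OF that] CS by blast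
  have f: "f q = \<Omega> (inv_into (Pi\<^sub>E {..<n} (\<lambda>_. U)) (power_coords n m (\<lambda>_. y)) q)" if q: "q \<in> Q" for q
  proof -
    have "q \<in> topspace (Euclidean_space (n * m))" using q openin_subset[OF Q(1)] by blast
    then have cb: "concat_blocks n m (coord_block m q) = q" by (rule concat_blocks_coord_block)
    have yI: "y (I (coord_block m q j)) = coord_block m q j" if "j < n" for j
      using Q(3) q that by (auto simp: I_def f_inv_into_f)
    have "power_coords n m (\<lambda>_. y) (T q) = concat_blocks n m (coord_block m q)"
      unfolding power_coords_def concat_blocks_def T_def
      by (rule ext) (simp add: yI less_mult_imp_div_less)
    with cb have "power_coords n m (\<lambda>_. y) (T q) = q" by simp
    then have "inv_into (Pi\<^sub>E {..<n} (\<lambda>_. U)) (power_coords n m (\<lambda>_. y)) q = T q"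
      using inv_into_f_f[OF inj_on_power_coords[OF yU(3) yE] TU[OF q]] by metis
    then show ?thesis by (simp add: f_def)
  qed
  \<comment> \<open>normalization: a derivative that omits the block \<open>a\<close> vanishes\<close>
  have vanish: "foldr partial rs f P = 0"
    if rs: "set rs \<subseteq> {..<n * m}" "set rs \<inter> (\<lambda>l. a * m + l) ` {..<m} = {}" and a: "a < n" for rs a
  proof (rule foldr_partial_vanish[OF Q(1) rs _ Q(2)])
    fix q assume q: "q \<in> Q" "\<forall>r\<in>(\<lambda>l. a * m + l) ` {..<m}. q r = P r"
    then have "coord_block m q a = coord_block m P a" by (auto simp: coord_block_def)
    then have "T q a = idn \<Gamma> x" using a blkP[OF a] Ip by (simp add: T_def p_def)
    then show "f q = 0"
      using assms(4,6) TS[OF q(1)] a unfolding normalized_def f_def by blast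
  qed simp
  let ?F = "\<lambda>q. \<Omega> (inv_into (Pi\<^sub>E {..<n} (\<lambda>_. U)) (power_coords n m (\<lambda>_. y)) q)"
  have taylor: "taylor_poly (n * m) n ?F P z
      = (\<Sum>i \<in> {..<n} \<rightarrow>\<^sub>E {..<m}. c i * of_real (\<Prod>a<n. z (a * m + i a) - P (a * m + i a)))" for z
  proof -
    have eq: "foldr partial rs ?F P = foldr partial rs f P" if "set rs \<subseteq> {..<n * m}" for rs
      by (rule foldr_partial_cong[OF Q(1) f[symmetric] that Q(2)])
    have "multi_partial (n * m) \<alpha> ?F P = 0"
      if "a < n" "\<forall>l<m. \<alpha> (a * m + l) = 0" for \<alpha> a
      unfolding multi_partial_eq_foldr
      by (subst eq, force, rule vanish[OF _ _ that(1)]) (use that(2) in auto)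
    from taylor_poly_one_per_block[OF Q(1) Ck_on_cong[OF Q(1) f Q(4)] Q(2) this]
    have "taylor_poly (n * m) n ?F P z
      = (\<Sum>i \<in> {..<n} \<rightarrow>\<^sub>E {..<m}.
          foldr partial (map (\<lambda>a. a * m + i a) [0..<n]) ?F P *
          of_real (\<Prod>a<n. z (a * m + i a) - P (a * m + i a)))" .
    also have "\<dots> = (\<Sum>i \<in> {..<n} \<rightarrow>\<^sub>E {..<m}. c i * of_real (\<Prod>a<n. z (a * m + i a) - P (a * m + i a)))"
    proof (rule sum.cong[OF refl])
      fix i assume "i \<in> {..<n} \<rightarrow>\<^sub>E {..<m}"
      then have im: "i a < m" if "a < n" for a using that by (simp add: PiE_iff)
      have sub: "set (map (\<lambda>a. a * m + i a) [0..<n]) \<subseteq> {..<n * m}"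
      proof
        fix r assume "r \<in> set (map (\<lambda>a. a * m + i a) [0..<n])"
        then obtain a where "a < n" "r = a * m + i a" by auto
        then show "r \<in> {..<n * m}" using block_index_less[OF _ im] by simp
      qed
      show "foldr partial (map (\<lambda>a. a * m + i a) [0..<n]) ?F P *
          of_real (\<Prod>a<n. z (a * m + i a) - P (a * m + i a))
          = c i * of_real (\<Prod>a<n. z (a * m + i a) - P (a * m + i a))"
        by (simp only: c_def eq[OF sub])
    qed
    finally show ?thesis .
  qed
  have anti: "c (\<lambda>j\<in>{..<n}. i (\<sigma> j)) = of_int (sign \<sigma>) * c i"
    if i: "i \<in> {..<n} \<rightarrow>\<^sub>E {..<m}" and \<sigma>: "\<sigma> permutes {..<n}" for i \<sigma>
  proof -
    have \<sigma>n: "\<sigma> j < n" if "j < n" for j using that permutes_in_image[OF \<sigma>] by auto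
    \<comment> \<open>all blocks of \<open>P\<close> are equal to \<open>y p\<close>\<close>
    have "P \<circ> block_permutation n m \<sigma> = P"
    proof
      fix r
      show "(P \<circ> block_permutation n m \<sigma>) r = P r"
      proof (cases "r < n * m")
        case True
        have l: "r mod m < m" using True by (intro mod_less_divisor) (cases m; simp)
        have a: "r div m < n" using True by (simp add: less_mult_imp_div_less)
        have "coord_block m P (\<sigma> (r div m)) (r mod m) = coord_block m P (r div m) (r mod m)"
          by (simp add: blkP a \<sigma>n)
        then show ?thesis using True l by (simp add: coord_block_def block_permutation_def)
      qed (simp add: block_permutation_def)
    qed
    moreover have "f (q \<circ> block_permutation n m \<sigma>) = of_int (sign \<sigma>) * f q" if "q \<in> Q" for q
    proof -
      have "T (q \<circ> block_permutation n m \<sigma>) = (\<lambda>j. T q (\<sigma> j))"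
      proof
        fix j
        show "T (q \<circ> block_permutation n m \<sigma>) j = T q (\<sigma> j)"
          using \<sigma>n permutes_not_in[OF \<sigma>] by (cases "j < n") (simp_all add: T_def coord_block_permute)
      qed
      then show ?thesis using assms(5) \<sigma> TS[OF that] unfolding antisymmetric_def f_def by simp
    qed
    ultimately have "foldr partial (map (\<lambda>a. a * m + i (\<sigma> a)) [0..<n]) f P = of_int (sign \<sigma>) * c i"
      unfolding c_def using i by (intro foldr_partial_permute_blocks[OF Q(1,4,2) \<sigma>]) auto
    moreover have "map (\<lambda>a. a * m + (\<lambda>j\<in>{..<n}. i (\<sigma> j)) a) [0..<n] = map (\<lambda>a. a * m + i (\<sigma> a)) [0..<n]"
      by simp
    ultimately show ?thesis by (simp only: c_def)
  qed
  have VE: "van_Est n \<Omega> (V i) = fact n * c i" if i: "i \<in> {..<n} \<rightarrow>\<^sub>E {..<m}" for i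
  proof -
    have "iterated_derivative (V i) n (Alt n \<Omega>) = c i"
      unfolding c_def
    proof (rule iterated_derivative_eq_foldr_partial[OF Q(1,2) blkP _ _ order_refl Q(4)])
      show "V i j g = partial (i j) (\<lambda>q. g (I q)) (y p)" for j g
        by (simp add: V_def coord_vector_def I_def p_def)
      show "Alt n \<Omega> (\<lambda>j. if j < n then I (coord_block m q j) else undefined) = f q" if "q \<in> Q" for q
      proof -
        have "(\<lambda>j. if j < n then I (coord_block m q j) else undefined) = T q"
          by (auto simp: T_def)
        then show ?thesis using Alt_antisymmetric[OF assms(5) TS[OF that]] by (simp add: f_def)
      qed
    qed (use i in auto)
    then show ?thesis by (simp add: van_Est_def)
  qed
  have "taylor_poly (n * m) n ?F P (concat_blocks n m z)
      = (\<Sum>i \<in> {i \<in> {..<n} \<rightarrow>\<^sub>E {..<m}. strict_mono_on {..<n} i}.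
          1 / fact n * van_Est n \<Omega> (V i) *
          of_real (Vol_simplex n (\<lambda>b. y p (i b)) (\<lambda>a b. z a (i b))))" for z :: "nat \<Rightarrow> nat \<Rightarrow> real"
  proof -
    have "(\<Prod>a<n. concat_blocks n m z (a * m + i a) - P (a * m + i a)) = (\<Prod>a<n. z a (i a) - y p (i a))"
      if i: "i \<in> {..<n} \<rightarrow>\<^sub>E {..<m}" for i
    proof (rule prod.cong[OF refl])
      fix a assume "a \<in> {..<n}"
      then have a: "a < n" and ia: "i a < m" using i by auto
      show "concat_blocks n m z (a * m + i a) - P (a * m + i a) = z a (i a) - y p (i a)"
        using block_index_less[OF a ia] ia by (simp add: P concat_blocks_def)
    qed
    then have "taylor_poly (n * m) n ?F P (concat_blocks n m z)
      = (\<Sum>i \<in> {..<n} \<rightarrow>\<^sub>E {..<m}. c i * of_real (\<Prod>a<n. z a (i a) - y p (i a)))"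
      unfolding taylor by (intro sum.cong) simp_all
    also have "\<dots> = (\<Sum>i \<in> {i \<in> {..<n} \<rightarrow>\<^sub>E {..<m}. strict_mono_on {..<n} i}.
       c i * of_real (Determinant.det (Matrix.mat n n (\<lambda>(a, b). z a (i b) - y p (i b)))))"
      by (rule sum_antisymmetric_eq_sum_det[OF anti])
    also have "\<dots> = (\<Sum>i \<in> {i \<in> {..<n} \<rightarrow>\<^sub>E {..<m}. strict_mono_on {..<n} i}.
          1 / fact n * van_Est n \<Omega> (V i) *
          of_real (Vol_simplex n (\<lambda>b. y p (i b)) (\<lambda>a b. z a (i b))))"
      by (rule sum.cong[OF refl]) (simp add: VE Vol_simplex_def)
    finally show ?thesis .
  qed
  moreover have "\<forall>i<m. coord_vector U y (idn \<Gamma> x) i \<in> algebroid_fiber \<Gamma> x"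
    unfolding algebroid_fiber_def using coord_vector_in_tangent_space[OF M y assms(8)] by blast
  ultimately show ?thesis unfolding P_def V_def p_def by blast
qed

end
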